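(* Let $H$ be a Hopf algebra over a field $\Bbbk$, let $(\rightharpoonup,A,\leftharpoonup)$ be a partial $H$-bimodule algebra and $(\lambda,\bar A,\rho)$ a partial $H$-bicomodule algebra. Then the $(L,R)$-smash product $A\natural\bar A$ is an associative algebra.
   Context: Algebras are over $\Bbbk$, associative, not necessarily unital; $\otimes=\otimes_\Bbbk$. $\Delta(h)=h_1\otimes h_2$ (summation understood) and $\varepsilon$ are the comultiplication and counit of $H$; $I$ denotes identity maps. A partial $H$-bimodule algebra $(\rightharpoonup,A,\leftharpoonup)$ is an algebra $A$ (not necessarily unital) with linear maps $\rightharpoonup:H\otimes A\to A$, $\leftharpoonup:A\otimes H\to A$ such that for all $a,b\in A$, $g,h\in H$: $1_H\rightharpoonup a=a$; $h\rightharpoonup[a(g\rightharpoonup b)]=(h_1\rightharpoonup a)(h_2g\rightharpoonup b)$; $a\leftharpoonup 1_H=a$; $[(b\leftharpoonup g)a]\leftharpoonup h=(b\leftharpoonup gh_1)(a\leftharpoonup h_2)$; $h\rightharpoonup(a\leftharpoonup g)=(h\rightharpoonup a)\leftharpoonup g$. A partial $H$-bicomodule algebra $(\lambda,\bar A,\rho)$ is a unital algebra $\bar A$ with multiplicative linear maps $\rho:\bar A\to\bar A\otimes H$, $\lambda:\bar A\to H\otimes\bar A$ such that for all $u\in\bar A$: $(I\otimes\varepsilon)\rho(u)=u$; $(\rho\otimes I_H)\rho(u)=(\rho(1_{\bar A})\otimes 1_H)[(I\otimes\Delta)\rho(u)]$; $(\varepsilon\otimes I)\lambda(u)=u$; $(I_H\otimes\lambda)\lambda(u)=[(\Delta\otimes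 I)\lambda(u)](1_H\otimes\lambda(1_{\bar A}))$; and $(I_H\otimes\rho)\lambda=(\lambda\otimes I_H)\rho$. Write $\rho(u)=u^{+\bar 0}\otimes u^{+\bar 1}\in\bar A\otimes H$ and $\lambda(u)=u^{-\bar 1}\otimes u^{-\bar 0}\in H\otimes\bar A$ (summation understood). The $(L,R)$-smash product $A\natural\bar A$ is the vector space $A\otimes\bar A$ (with $a\otimes u$ written $a\natural u$) with multiplication $$(a\natural u)(b\natural v)=(a\leftharpoonup v^{+\bar 1})(u^{-\bar 1}\rightharpoonup b)\natural u^{-\bar 0}v^{+\bar 0},\qquad a,b\in A,\ u,v\in\bar A.$$ *)

theory Defs
  imports "HOL-Algebra.Module" "HOL-Algebra.AbelCoset"
begin

section \<open>Linear maps and tensor products\<close>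

definition linear_maps ::
    "('k, 'm) ring_scheme \<Rightarrow> ('k, 'v) module \<Rightarrow> ('k, 'w) module \<Rightarrow> ('v \<Rightarrow> 'w) set"
  where "linear_maps K V W =
    {f \<in> carrier V \<rightarrow> carrier W.
      (\<forall>x\<in>carrier V. \<forall>y\<in>carrier V. f (x \<oplus>\<^bsub>V\<^esub> y) = f x \<oplus>\<^bsub>W\<^esub> f y) \<and>
      (\<forall>c\<in>carrier K. \<forall>x\<in>carrier V. f (c \<odot>\<^bsub>V\<^esub> x) = c \<odot>\<^bsub>W\<^esub> f x)}"

definition ground_module :: "('k, 'm) ring_scheme \<Rightarrow> ('k, 'k) module"
  where "ground_module K =
    \<lparr>carrier = carrier K, mult = mult K, one = one K, zero = zero K, add = add K, smult = mult K\<rparr>"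

text \<open>The free module on a set of generators: finitely supported functions vanishing outside that
  set. The record fields \<open>mult\<close> and \<open>one\<close> are irrelevant for a mere module.\<close>

definition free_module :: "('k, 'm) ring_scheme \<Rightarrow> 'x set \<Rightarrow> ('k, 'x \<Rightarrow> 'k) module"
  where "free_module K X =
    \<lparr>carrier = {f. (\<forall>x. f x \<in> carrier K) \<and> (\<forall>x. x \<notin> X \<longrightarrow> f x = \<zero>\<^bsub>K\<^esub>) \<and>
                   finite {x. f x \<noteq> \<zero>\<^bsub>K\<^esub>}},
     mult = undefined, one = undefined,
     zero = (\<lambda>x. \<zero>\<^bsub>K\<^esub>),
     add = (\<lambda>f g x. f x \<oplus>\<^bsub>K\<^esub> g x),
     smult = (\<lambda>c f x. c \<otimes>\<^bsub>K\<^esub> f x)\<rparr>"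

definition free_gen :: "('k, 'm) ring_scheme \<Rightarrow> 'x \<Rightarrow> 'x \<Rightarrow> 'k"
  where "free_gen K x = (\<lambda>y. if y = x then \<one>\<^bsub>K\<^esub> else \<zero>\<^bsub>K\<^esub>)"

definition submodule_span :: "('k, 'm) ring_scheme \<Rightarrow> ('k, 'v) module \<Rightarrow> 'v set \<Rightarrow> 'v set"
  where "submodule_span K V G = \<Inter> {N. submodule N K V \<and> G \<subseteq> N}"

definition quotient_module ::
    "('k, 'm) ring_scheme \<Rightarrow> ('k, 'v) module \<Rightarrow> 'v set \<Rightarrow> ('k, 'v set) module"
  where "quotient_module K V N =
    \<lparr>carrier = a_rcosets\<^bsub>V\<^esub> N, mult = undefined, one = undefined,
     zero = N, add = set_add V,
     smult = (\<lambda>c X. \<Union>x\<in>X. N +>\<^bsub>V\<^esub> (c \<odot>\<^bsub>V\<^esub> x))\<rparr>"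

definition tensor_relators ::
    "('k, 'm) ring_scheme \<Rightarrow> ('k, 'v) module \<Rightarrow> ('k, 'w) module \<Rightarrow> ('v \<times> 'w \<Rightarrow> 'k) set"
  where "tensor_relators K V W =
    (let F = free_module K (carrier V \<times> carrier W); e = (\<lambda>v w. free_gen K (v, w)) in
      {e (v \<oplus>\<^bsub>V\<^esub> v') w \<ominus>\<^bsub>F\<^esub> (e v w \<oplus>\<^bsub>F\<^esub> e v' w) | v v' w.
          v \<in> carrier V \<and> v' \<in> carrier V \<and> w \<in> carrier W} \<union>
      {e v (w \<oplus>\<^bsub>W\<^esub> w') \<ominus>\<^bsub>F\<^esub> (e v w \<oplus>\<^bsub>F\<^esub> e v w') | v w w'.
          v \<in> carrier V \<and> w \<in> carrier W \<and> w' \<in> carrier W} \<union>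
      {e (c \<odot>\<^bsub>V\<^esub> v) w \<ominus>\<^bsub>F\<^esub> (c \<odot>\<^bsub>F\<^esub> e v w) | c v w.
          c \<in> carrier K \<and> v \<in> carrier V \<and> w \<in> carrier W} \<union>
      {e v (c \<odot>\<^bsub>W\<^esub> w) \<ominus>\<^bsub>F\<^esub> (c \<odot>\<^bsub>F\<^esub> e v w) | c v w.
          c \<in> carrier K \<and> v \<in> carrier V \<and> w \<in> carrier W})"

definition tensor_null ::
    "('k, 'm) ring_scheme \<Rightarrow> ('k, 'v) module \<Rightarrow> ('k, 'w) module \<Rightarrow> ('v \<times> 'w \<Rightarrow> 'k) set"
  where "tensor_null K V W =
    submodule_span K (free_module K (carrier V \<times> carrier W)) (tensor_relators K V W)"

definition tensor_module ::
    "('k, 'm) ring_scheme \<Rightarrow> ('k, 'v) module \<Rightarrow> ('k, 'w) module \<Rightarrow>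
     ('k, ('v \<times> 'w \<Rightarrow> 'k) set) module"
  where "tensor_module K V W =
    quotient_module K (free_module K (carrier V \<times> carrier W)) (tensor_null K V W)"

text \<open>The pure tensor of \<open>v\<close> and \<open>w\<close>.\<close>

definition tens ::
    "('k, 'm) ring_scheme \<Rightarrow> ('k, 'v) module \<Rightarrow> ('k, 'w) module \<Rightarrow> 'v \<Rightarrow> 'w \<Rightarrow>
     ('v \<times> 'w \<Rightarrow> 'k) set"
  where "tens K V W v w =
    tensor_null K V W +>\<^bsub>free_module K (carrier V \<times> carrier W)\<^esub> free_gen K (v, w)"

text \<open>The linear map on a tensor product with values in \<open>P\<close> induced by a bilinear map \<open>b\<close>,
  evaluated at a tensor \<open>t\<close> through an arbitrary representing formal sum. This doubles as
  Sweedler notation: a summation \<open>b h\<^sub>1 h\<^sub>2\<close> over \<open>\<Delta> h = h\<^sub>1 \<otimes> h\<^sub>2\<close>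
  is \<open>tensor_lift K P b (\<Delta> h)\<close>.\<close>

definition tensor_lift ::
    "('k, 'm) ring_scheme \<Rightarrow> ('k, 'p) module \<Rightarrow> ('v \<Rightarrow> 'w \<Rightarrow> 'p) \<Rightarrow> ('v \<times> 'w \<Rightarrow> 'k) set \<Rightarrow> 'p"
  where "tensor_lift K P b t =
    (let f = (SOME f. f \<in> t) in
      \<Oplus>\<^bsub>P\<^esub>p\<in>{p. f p \<noteq> \<zero>\<^bsub>K\<^esub>}. f p \<odot>\<^bsub>P\<^esub> b (fst p) (snd p))"

text \<open>The tensor product, including \<open>(v \<otimes> w) (v' \<otimes> w') = v v' \<otimes> w w'\<close> and \<open>1 \<otimes> 1\<close>. These two
  fields are only meaningful if both factors are (unital) algebras.\<close>

definition tensor ::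
    "('k, 'm) ring_scheme \<Rightarrow> ('k, 'v) module \<Rightarrow> ('k, 'w) module \<Rightarrow>
     ('k, ('v \<times> 'w \<Rightarrow> 'k) set) module"
  where "tensor K V W = (tensor_module K V W)
    \<lparr>mult := (\<lambda>s t.
        tensor_lift K (tensor_module K V W) (\<lambda>v w.
          tensor_lift K (tensor_module K V W) (\<lambda>v' w'.
            tens K V W (v \<otimes>\<^bsub>V\<^esub> v') (w \<otimes>\<^bsub>W\<^esub> w')) t) s),
      one := tens K V W \<one>\<^bsub>V\<^esub> \<one>\<^bsub>W\<^esub>\<rparr>"

text \<open>\<open>f \<otimes> g\<close> with values in \<open>V \<otimes> W\<close>.\<close>

definition tensor_map ::
    "('k, 'm) ring_scheme \<Rightarrow> ('k, 'v) module \<Rightarrow> ('k, 'w) module \<Rightarrow> ('x \<Rightarrow> 'v) \<Rightarrow> ('y \<Rightarrow> 'w) \<Rightarrow>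
     ('x \<times> 'y \<Rightarrow> 'k) set \<Rightarrow> ('v \<times> 'w \<Rightarrow> 'k) set"
  where "tensor_map K V W f g = tensor_lift K (tensor K V W) (\<lambda>x y. tens K V W (f x) (g y))"

text \<open>The canonical isomorphisms \<open>(V \<otimes> W) \<otimes> X \<rightarrow> V \<otimes> (W \<otimes> X)\<close>, \<open>K \<otimes> V \<rightarrow> V\<close> and \<open>V \<otimes> K \<rightarrow> V\<close>.\<close>

definition tensor_assoc ::
    "('k, 'm) ring_scheme \<Rightarrow> ('k, 'v) module \<Rightarrow> ('k, 'w) module \<Rightarrow> ('k, 'x) module \<Rightarrow>
     (('v \<times> 'w \<Rightarrow> 'k) set \<times> 'x \<Rightarrow> 'k) set \<Rightarrow> ('v \<times> ('w \<times> 'x \<Rightarrow> 'k) set \<Rightarrow> 'k) set"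
  where "tensor_assoc K V W X =
    tensor_lift K (tensor K V (tensor K W X)) (\<lambda>t x.
      tensor_lift K (tensor K V (tensor K W X)) (\<lambda>v w.
        tens K V (tensor K W X) v (tens K W X w x)) t)"

definition left_unitor ::
    "('k, 'm) ring_scheme \<Rightarrow> ('k, 'v) module \<Rightarrow> ('k \<times> 'v \<Rightarrow> 'k) set \<Rightarrow> 'v"
  where "left_unitor K V = tensor_lift K V (\<lambda>c v. c \<odot>\<^bsub>V\<^esub> v)"

definition right_unitor ::
    "('k, 'm) ring_scheme \<Rightarrow> ('k, 'v) module \<Rightarrow> ('v \<times> 'k \<Rightarrow> 'k) set \<Rightarrow> 'v"
  where "right_unitor K V = tensor_lift K V (\<lambda>v c. c \<odot>\<^bsub>V\<^esub> v)"


section \<open>Algebras and Hopf algebras\<close>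

text \<open>Not necessarily commutative or unital, unlike the library's locale \<open>algebra\<close>; the field
  \<open>one\<close> of the record is unconstrained.\<close>

locale assoc_algebra = field K + module K A
  for K :: "('k, 'm) ring_scheme" and A :: "('k, 'a) module" +
  assumes mult_closed:
      "\<lbrakk>x \<in> carrier A; y \<in> carrier A\<rbrakk> \<Longrightarrow> x \<otimes>\<^bsub>A\<^esub> y \<in> carrier A"
    and mult_assoc:
      "\<lbrakk>x \<in> carrier A; y \<in> carrier A; z \<in> carrier A\<rbrakk> \<Longrightarrow>
        (x \<otimes>\<^bsub>A\<^esub> y) \<otimes>\<^bsub>A\<^esub> z = x \<otimes>\<^bsub>A\<^esub> (y \<otimes>\<^bsub>A\<^esub> z)"
    and mult_add_left:
      "\<lbrakk>x \<in> carrier A; y \<in> carrier A; z \<in> carrier A\<rbrakk> \<Longrightarrow>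
        (x \<oplus>\<^bsub>A\<^esub> y) \<otimes>\<^bsub>A\<^esub> z = x \<otimes>\<^bsub>A\<^esub> z \<oplus>\<^bsub>A\<^esub> y \<otimes>\<^bsub>A\<^esub> z"
    and mult_add_right:
      "\<lbrakk>x \<in> carrier A; y \<in> carrier A; z \<in> carrier A\<rbrakk> \<Longrightarrow>
        x \<otimes>\<^bsub>A\<^esub> (y \<oplus>\<^bsub>A\<^esub> z) = x \<otimes>\<^bsub>A\<^esub> y \<oplus>\<^bsub>A\<^esub> x \<otimes>\<^bsub>A\<^esub> z"
    and mult_smult_left:
      "\<lbrakk>c \<in> carrier K; x \<in> carrier A; y \<in> carrier A\<rbrakk> \<Longrightarrow>
        (c \<odot>\<^bsub>A\<^esub> x) \<otimes>\<^bsub>A\<^esub> y = c \<odot>\<^bsub>A\<^esub> (x \<otimes>\<^bsub>A\<^esub> y)"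
    and mult_smult_right:
      "\<lbrakk>c \<in> carrier K; x \<in> carrier A; y \<in> carrier A\<rbrakk> \<Longrightarrow>
        x \<otimes>\<^bsub>A\<^esub> (c \<odot>\<^bsub>A\<^esub> y) = c \<odot>\<^bsub>A\<^esub> (x \<otimes>\<^bsub>A\<^esub> y)"

locale unital_algebra = assoc_algebra K A + A: Group.monoid A
  for K :: "('k, 'm) ring_scheme" and A :: "('k, 'a) module"

locale hopf_algebra = unital_algebra K H
  for K :: "('k, 'm) ring_scheme" and H :: "('k, 'h) module"
  and \<Delta> :: "'h \<Rightarrow> ('h \<times> 'h \<Rightarrow> 'k) set" and \<epsilon> :: "'h \<Rightarrow> 'k" and S :: "'h \<Rightarrow> 'h" +
  assumes comult_linear: "\<Delta> \<in> linear_maps K H (tensor K H H)"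
    and counit_linear: "\<epsilon> \<in> linear_maps K H (ground_module K)"
    and coassoc: "h \<in> carrier H \<Longrightarrow>
      tensor_assoc K H H H (tensor_map K (tensor K H H) H \<Delta> id (\<Delta> h)) =
      tensor_map K H (tensor K H H) id \<Delta> (\<Delta> h)"
    and counit_left: "h \<in> carrier H \<Longrightarrow>
      left_unitor K H (tensor_map K (ground_module K) H \<epsilon> id (\<Delta> h)) = h"
    and counit_right: "h \<in> carrier H \<Longrightarrow>
      right_unitor K H (tensor_map K H (ground_module K) id \<epsilon> (\<Delta> h)) = h"
    and comult_mult: "\<lbrakk>g \<in> carrier H; h \<in> carrier H\<rbrakk> \<Longrightarrow>
      \<Delta> (g \<otimes>\<^bsub>H\<^esub> h) = \<Delta> g \<otimes>\<^bsub>tensor K H H\<^esub> \<Delta> h"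
    and comult_one: "\<Delta> \<one>\<^bsub>H\<^esub> = \<one>\<^bsub>tensor K H H\<^esub>"
    and counit_mult: "\<lbrakk>g \<in> carrier H; h \<in> carrier H\<rbrakk> \<Longrightarrow> \<epsilon> (g \<otimes>\<^bsub>H\<^esub> h) = \<epsilon> g \<otimes>\<^bsub>K\<^esub> \<epsilon> h"
    and counit_one: "\<epsilon> \<one>\<^bsub>H\<^esub> = \<one>\<^bsub>K\<^esub>"
    and antipode_linear: "S \<in> linear_maps K H H"
    and antipode_left: "h \<in> carrier H \<Longrightarrow>
      tensor_lift K H (\<lambda>h\<^sub>1 h\<^sub>2. S h\<^sub>1 \<otimes>\<^bsub>H\<^esub> h\<^sub>2) (\<Delta> h) = \<epsilon> h \<odot>\<^bsub>H\<^esub> \<one>\<^bsub>H\<^esub>"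
    and antipode_right: "h \<in> carrier H \<Longrightarrow>
      tensor_lift K H (\<lambda>h\<^sub>1 h\<^sub>2. h\<^sub>1 \<otimes>\<^bsub>H\<^esub> S h\<^sub>2) (\<Delta> h) = \<epsilon> h \<odot>\<^bsub>H\<^esub> \<one>\<^bsub>H\<^esub>"


section \<open>Partial bimodule and bicomodule algebras\<close>

text \<open>The actions are linear maps \<open>L\<close> on \<open>H \<otimes> A\<close> and \<open>R\<close> on \<open>A \<otimes> H\<close>;
  \<open>lact h a\<close> and \<open>ract a h\<close> are their values on pure tensors.\<close>

locale partial_bimodule_algebra = assoc_algebra K A
  for K :: "('k, 'm) ring_scheme" and H :: "('k, 'h) module"
  and \<Delta> :: "'h \<Rightarrow> ('h \<times> 'h \<Rightarrow> 'k) set"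
  and L :: "('h \<times> 'a \<Rightarrow> 'k) set \<Rightarrow> 'a" and A :: "('k, 'a) module"
  and R :: "('a \<times> 'h \<Rightarrow> 'k) set \<Rightarrow> 'a" +
  fixes lact :: "'h \<Rightarrow> 'a \<Rightarrow> 'a" (infixr \<open>\<rightharpoonup>\<close> 75) and ract :: "'a \<Rightarrow> 'h \<Rightarrow> 'a" (infixl \<open>\<leftharpoonup>\<close> 75)
  defines "lact h a \<equiv> L (tens K H A h a)"
    and "ract a h \<equiv> R (tens K A H a h)"
  assumes left_linear: "L \<in> linear_maps K (tensor K H A) A"
    and right_linear: "R \<in> linear_maps K (tensor K A H) A"
    and left_one: "a \<in> carrier A \<Longrightarrow> \<one>\<^bsub>H\<^esub> \<rightharpoonup> a = a"
    and left_partial: "\<lbrakk>h \<in> carrier H; g \<in> carrier H; a \<in> carrier A; b \<in> carrier A\<rbrakk> \<Longrightarrow>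
      h \<rightharpoonup> (a \<otimes>\<^bsub>A\<^esub> (g \<rightharpoonup> b)) =
      tensor_lift K A (\<lambda>h\<^sub>1 h\<^sub>2. (h\<^sub>1 \<rightharpoonup> a) \<otimes>\<^bsub>A\<^esub> ((h\<^sub>2 \<otimes>\<^bsub>H\<^esub> g) \<rightharpoonup> b)) (\<Delta> h)"
    and right_one: "a \<in> carrier A \<Longrightarrow> a \<leftharpoonup> \<one>\<^bsub>H\<^esub> = a"
    and right_partial: "\<lbrakk>h \<in> carrier H; g \<in> carrier H; a \<in> carrier A; b \<in> carrier A\<rbrakk> \<Longrightarrow>
      ((b \<leftharpoonup> g) \<otimes>\<^bsub>A\<^esub> a) \<leftharpoonup> h =
      tensor_lift K A (\<lambda>h\<^sub>1 h\<^sub>2. (b \<leftharpoonup> (g \<otimes>\<^bsub>H\<^esub> h\<^sub>1)) \<otimes>\<^bsub>A\<^esub> (a \<leftharpoonup> h\<^sub>2)) (\<Delta> h)"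
    and left_right: "\<lbrakk>h \<in> carrier H; g \<in> carrier H; a \<in> carrier A\<rbrakk> \<Longrightarrow>
      h \<rightharpoonup> (a \<leftharpoonup> g) = (h \<rightharpoonup> a) \<leftharpoonup> g"

text \<open>Identities between threefold tensor products are stated in the right-nested form.\<close>

locale partial_bicomodule_algebra = unital_algebra K B
  for K :: "('k, 'm) ring_scheme" and H :: "('k, 'h) module"
  and \<Delta> :: "'h \<Rightarrow> ('h \<times> 'h \<Rightarrow> 'k) set" and \<epsilon> :: "'h \<Rightarrow> 'k"
  and lam :: "'b \<Rightarrow> ('h \<times> 'b \<Rightarrow> 'k) set" and B :: "('k, 'b) module"
  and rho :: "'b \<Rightarrow> ('b \<times> 'h \<Rightarrow> 'k) set" +
  assumes rho_linear: "rho \<in> linear_maps K B (tensor K B H)"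
    and rho_mult: "\<lbrakk>u \<in> carrier B; v \<in> carrier B\<rbrakk> \<Longrightarrow>
      rho (u \<otimes>\<^bsub>B\<^esub> v) = rho u \<otimes>\<^bsub>tensor K B H\<^esub> rho v"
    and lam_linear: "lam \<in> linear_maps K B (tensor K H B)"
    and lam_mult: "\<lbrakk>u \<in> carrier B; v \<in> carrier B\<rbrakk> \<Longrightarrow>
      lam (u \<otimes>\<^bsub>B\<^esub> v) = lam u \<otimes>\<^bsub>tensor K H B\<^esub> lam v"
    and rho_counit: "u \<in> carrier B \<Longrightarrow>
      right_unitor K B (tensor_map K B (ground_module K) id \<epsilon> (rho u)) = u"
    and rho_partial: "u \<in> carrier B \<Longrightarrow>
      tensor_assoc K B H H (tensor_map K (tensor K B H) H rho id (rho u)) =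
      tensor_assoc K B H H (tens K (tensor K B H) H (rho \<one>\<^bsub>B\<^esub>) \<one>\<^bsub>H\<^esub>)
        \<otimes>\<^bsub>tensor K B (tensor K H H)\<^esub> tensor_map K B (tensor K H H) id \<Delta> (rho u)"
    and lam_counit: "u \<in> carrier B \<Longrightarrow>
      left_unitor K B (tensor_map K (ground_module K) B \<epsilon> id (lam u)) = u"
    and lam_partial: "u \<in> carrier B \<Longrightarrow>
      tensor_map K H (tensor K H B) id lam (lam u) =
      tensor_assoc K H H B (tensor_map K (tensor K H H) B \<Delta> id (lam u))
        \<otimes>\<^bsub>tensor K H (tensor K H B)\<^esub> tens K H (tensor K H B) \<one>\<^bsub>H\<^esub> (lam \<one>\<^bsub>B\<^esub>)"
    and lam_rho: "u \<in> carrier B \<Longrightarrow>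
      tensor_map K H (tensor K B H) id rho (lam u) =
      tensor_assoc K H B H (tensor_map K (tensor K H B) H lam id (rho u))"


section \<open>The (L,R)-smash product\<close>

text \<open>In the multiplication, \<open>h \<otimes> u'\<close> runs through \<open>\<lambda>(u)\<close> and \<open>v' \<otimes> g\<close> through \<open>\<rho>(v)\<close>.
  In general there is no unit, so \<open>one\<close> is left unspecified.\<close>

definition smash_product ::
    "('k, 'm) ring_scheme \<Rightarrow> ('k, 'h) module \<Rightarrow>
     (('h \<times> 'a \<Rightarrow> 'k) set \<Rightarrow> 'a) \<Rightarrow> ('k, 'a) module \<Rightarrow> (('a \<times> 'h \<Rightarrow> 'k) set \<Rightarrow> 'a) \<Rightarrow>
     ('b \<Rightarrow> ('h \<times> 'b \<Rightarrow> 'k) set) \<Rightarrow> ('k, 'b) module \<Rightarrow> ('b \<Rightarrow> ('b \<times> 'h \<Rightarrow> 'k) set) \<Rightarrow>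
     ('k, ('a \<times> 'b \<Rightarrow> 'k) set) module"
  where "smash_product K H L A R lam B rho =
    (let M = tensor_module K A B in
      M\<lparr>mult := (\<lambda>s t.
        tensor_lift K M (\<lambda>a u.
          tensor_lift K M (\<lambda>b v.
            tensor_lift K M (\<lambda>h u'.
              tensor_lift K M (\<lambda>v' g.
                tens K A B
                  (R (tens K A H a g) \<otimes>\<^bsub>A\<^esub> L (tens K H A h b))
                  (u' \<otimes>\<^bsub>B\<^esub> v'))
              (rho v))
            (lam u))
          t)
        s),
      one := undefined\<rparr>)"

end

theory Submission
  imports Defs
begin

text \<open>
  In Sweedler notation the theorem is a short calculation. Write \<open>\<lambda>(u) = h \<otimes> u'\<close> with \<open>h\<close> in \<open>H\<close>, and
  \<open>\<rho>(w) = w' \<otimes> g'\<close> with \<open>g'\<close> in \<open>H\<close>. Both iterated products of \<open>a \<natural> u\<close>, \<open>b \<natural> v\<close> and \<open>c \<natural> w\<close> equal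
  the sum of
  \<open>(a \<leftharpoonup> g g'\<^sub>1) (h\<^sub>1 \<rightharpoonup> b \<leftharpoonup> g'\<^sub>2) (h\<^sub>2 k \<rightharpoonup> c) \<natural> u' x w'\<close>,
  where \<open>k \<otimes> x \<otimes> g\<close> runs through \<open>(\<lambda> \<otimes> I)\<rho>(v) = (I \<otimes> \<rho>)\<lambda>(v)\<close>. For the product bracketed to the left,
  the right partial action creates \<open>g'\<^sub>1\<close> and \<open>g'\<^sub>2\<close>, and the multiplicativity and partial
  coassociativity of \<open>\<lambda>\<close> create \<open>h\<^sub>1\<close> and \<open>h\<^sub>2\<close>; the idempotent \<open>\<lambda>(1)\<close> occurring there is absorbed
  by \<open>\<lambda>\<close> of the next factor (\<open>lam_sum_twist\<close>). The product bracketed to the right is the mirror image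
  (\<open>rho_sum_twist\<close>). The two results differ by the compatibility of \<open>\<lambda>\<close> and \<open>\<rho>\<close> (\<open>lam_rho_sum\<close>) and by
  the order of summation (\<open>tensor_lift_swap\<close>).

  To make this calculation rigorous, \<open>tensor_lift\<close> is shown to be independent of the representing
  formal sum, which gives the universal property of the tensor product: \<open>tensor_lift_linear\<close>,
  \<open>tensor_lift_tens\<close> and \<open>tensor_ext\<close>. A Sweedler sum is then a value of a linear map, and each
  manipulation of nested sums is an equality of two linear maps that need only be compared on pure
  tensors. That all summands involved are multilinear follows by introduction rules that mirror the
  way in which the expressions are built.
\<close>

section \<open>Linear and bilinear maps\<close>

lemma linear_mapsI:
  assumes "\<And>x. x \<in> carrier V \<Longrightarrow> f x \<in> carrier W"
    and "\<And>x y. \<lbrakk>x \<in> carrier V; y \<in> carrier V\<rbrakk> \<Longrightarrow> f (x \<oplus>\<^bsub>V\<^esub> y) = f x \<oplus>\<^bsub>W\<^esub> f y"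
    and "\<And>c x. \<lbrakk>c \<in> carrier K; x \<in> carrier V\<rbrakk> \<Longrightarrow> f (c \<odot>\<^bsub>V\<^esub> x) = c \<odot>\<^bsub>W\<^esub> f x"
  shows "f \<in> linear_maps K V W"
  using assms by (auto simp: linear_maps_def)

lemma linear_closed:
  "\<lbrakk>f \<in> linear_maps K V W; x \<in> carrier V\<rbrakk> \<Longrightarrow> f x \<in> carrier W"
  by (auto simp: linear_maps_def)

lemma linear_add:
  "\<lbrakk>f \<in> linear_maps K V W; x \<in> carrier V; y \<in> carrier V\<rbrakk> \<Longrightarrow>
    f (x \<oplus>\<^bsub>V\<^esub> y) = f x \<oplus>\<^bsub>W\<^esub> f y"
  by (auto simp: linear_maps_def)

lemma linear_smult:
  "\<lbrakk>f \<in> linear_maps K V W; c \<in> carrier K; x \<in> carrier V\<rbrakk> \<Longrightarrow>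
    f (c \<odot>\<^bsub>V\<^esub> x) = c \<odot>\<^bsub>W\<^esub> f x"
  by (auto simp: linear_maps_def)

lemma linear_zero:
  assumes V: "module K V" and W: "module K W" and f: "f \<in> linear_maps K V W"
  shows "f \<zero>\<^bsub>V\<^esub> = \<zero>\<^bsub>W\<^esub>"
proof -
  interpret V: module K V by fact
  interpret W: module K W by fact
  have "f \<zero>\<^bsub>V\<^esub> = f (\<zero>\<^bsub>K\<^esub> \<odot>\<^bsub>V\<^esub> \<zero>\<^bsub>V\<^esub>)" by simp
  also have "\<dots> = \<zero>\<^bsub>K\<^esub> \<odot>\<^bsub>W\<^esub> f \<zero>\<^bsub>V\<^esub>"
    using f by (intro linear_smult) auto
  also have "\<dots> = \<zero>\<^bsub>W\<^esub>" using linear_closed[OF f] by simp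
  finally show ?thesis .
qed

lemma linear_uminus:
  assumes V: "module K V" and W: "module K W" and f: "f \<in> linear_maps K V W"
    and x: "x \<in> carrier V"
  shows "f (\<ominus>\<^bsub>V\<^esub> x) = \<ominus>\<^bsub>W\<^esub> f x"
proof -
  interpret V: module K V by fact
  interpret W: module K W by fact
  have "f (\<ominus>\<^bsub>V\<^esub> x) \<oplus>\<^bsub>W\<^esub> f x = \<zero>\<^bsub>W\<^esub>"
    using linear_add[OF f, of "\<ominus>\<^bsub>V\<^esub> x" x] x linear_zero[OF V W f] by (simp add: V.l_neg)
  then show ?thesis
    using linear_closed[OF f] x by (metis V.a_inv_closed W.minus_equality)
qed

lemma linear_diff:
  assumes V: "module K V" and W: "module K W" and f: "f \<in> linear_maps K V W"
    and x: "x \<in> carrier V" and y: "y \<in> carrier V"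
  shows "f (x \<ominus>\<^bsub>V\<^esub> y) = f x \<ominus>\<^bsub>W\<^esub> f y"
proof -
  interpret V: module K V by fact
  show ?thesis
    using x y by (simp add: a_minus_def linear_add[OF f] linear_uminus[OF V W f])
qed

lemma linear_kernel_submodule:
  assumes V: "module K V" and W: "module K W" and f: "f \<in> linear_maps K V W"
  shows "submodule {x \<in> carrier V. f x = \<zero>\<^bsub>W\<^esub>} K V"
proof -
  interpret V: module K V by fact
  interpret W: module K W by fact
  show ?thesis
    by (rule V.submoduleI)
       (auto simp: linear_zero[OF V W f] linear_uminus[OF V W f] linear_add[OF f]
         linear_smult[OF f])
qed

lemma linear_ident: "(\<lambda>x. x) \<in> linear_maps K V V"
  by (auto simp: linear_maps_def)

lemma linear_compose:
  assumes "g \<in> linear_maps K W P" "f \<in> linear_maps K V W"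
  shows "(\<lambda>x. g (f x)) \<in> linear_maps K V P"
  using assms by (auto simp: linear_maps_def Pi_iff)

text \<open>Maps \<open>b v w\<close> that are linear in each argument, the other one being fixed in the carrier;
  nothing is required outside the carriers.\<close>

definition bilinear_maps ::
    "('k, 'm) ring_scheme \<Rightarrow> ('k, 'v) module \<Rightarrow> ('k, 'w) module \<Rightarrow> ('k, 'p) module \<Rightarrow>
     ('v \<Rightarrow> 'w \<Rightarrow> 'p) set"
  where "bilinear_maps K V W P =
    {b. (\<forall>w\<in>carrier W. (\<lambda>v. b v w) \<in> linear_maps K V P) \<and>
        (\<forall>v\<in>carrier V. (\<lambda>w. b v w) \<in> linear_maps K W P)}"

lemma bilinearI:
  assumes "\<And>w. w \<in> carrier W \<Longrightarrow> (\<lambda>v. b v w) \<in> linear_maps K V P"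
    and "\<And>v. v \<in> carrier V \<Longrightarrow> (\<lambda>w. b v w) \<in> linear_maps K W P"
  shows "(\<lambda>v w. b v w) \<in> bilinear_maps K V W P"
  using assms by (simp add: bilinear_maps_def)

lemma bilinear_left:
  "\<lbrakk>b \<in> bilinear_maps K V W P; w \<in> carrier W\<rbrakk> \<Longrightarrow> (\<lambda>v. b v w) \<in> linear_maps K V P"
  by (simp add: bilinear_maps_def)

lemma bilinear_right:
  "\<lbrakk>b \<in> bilinear_maps K V W P; v \<in> carrier V\<rbrakk> \<Longrightarrow> (\<lambda>w. b v w) \<in> linear_maps K W P"
  by (simp add: bilinear_maps_def)

lemma bilinear_closed:
  "\<lbrakk>b \<in> bilinear_maps K V W P; v \<in> carrier V; w \<in> carrier W\<rbrakk> \<Longrightarrow> b v w \<in> carrier P"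
  using linear_closed[OF bilinear_left] by fastforce


section \<open>The free module\<close>

lemma carrier_free_module:
  "f \<in> carrier (free_module K X) \<longleftrightarrow>
    (\<forall>x. f x \<in> carrier K) \<and> (\<forall>x. x \<notin> X \<longrightarrow> f x = \<zero>\<^bsub>K\<^esub>) \<and> finite {x. f x \<noteq> \<zero>\<^bsub>K\<^esub>}"
  by (simp add: free_module_def)

lemma free_module_simps:
  "f \<oplus>\<^bsub>free_module K X\<^esub> g = (\<lambda>x. f x \<oplus>\<^bsub>K\<^esub> g x)"
  "\<zero>\<^bsub>free_module K X\<^esub> = (\<lambda>x. \<zero>\<^bsub>K\<^esub>)"
  "c \<odot>\<^bsub>free_module K X\<^esub> f = (\<lambda>x. c \<otimes>\<^bsub>K\<^esub> f x)"
  by (simp_all add: free_module_def)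

lemma free_module_is_module:
  fixes K :: "('k, 'm) ring_scheme" and X :: "'x set"
  assumes "cring K"
  shows "module K (free_module K X)"
proof -
  interpret cring K by fact
  have fin_add: "finite {x. f x \<oplus>\<^bsub>K\<^esub> g x \<noteq> \<zero>\<^bsub>K\<^esub>}"
    if "finite {x. f x \<noteq> \<zero>\<^bsub>K\<^esub>}" "finite {x. g x \<noteq> \<zero>\<^bsub>K\<^esub>}" for f g :: "'x \<Rightarrow> 'k"
    by (rule finite_subset[OF _ finite_UnI[OF that]]) auto
  have fin_smult: "finite {x. c \<otimes>\<^bsub>K\<^esub> f x \<noteq> \<zero>\<^bsub>K\<^esub>}"
    if "c \<in> carrier K" "finite {x. f x \<noteq> \<zero>\<^bsub>K\<^esub>}" for c and f :: "'x \<Rightarrow> 'k"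
    by (rule finite_subset[OF _ that(2)]) (use that(1) in auto)
  have fin_minus: "finite {x. \<ominus>\<^bsub>K\<^esub> f x \<noteq> \<zero>\<^bsub>K\<^esub>}"
    if "finite {x. f x \<noteq> \<zero>\<^bsub>K\<^esub>}" for f :: "'x \<Rightarrow> 'k"
    by (rule finite_subset[OF _ that]) auto
  show ?thesis
  proof (rule moduleI)
    show "abelian_group (free_module K X)"
    proof (rule abelian_groupI)
      fix f assume f: "f \<in> carrier (free_module K X)"
      then have "(\<lambda>x. \<ominus>\<^bsub>K\<^esub> f x) \<in> carrier (free_module K X)"
        by (auto simp: carrier_free_module fin_minus)
      moreover have "(\<lambda>x. \<ominus>\<^bsub>K\<^esub> f x) \<oplus>\<^bsub>free_module K X\<^esub> f = \<zero>\<^bsub>free_module K X\<^esub>"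
        using f by (auto simp: carrier_free_module free_module_simps l_neg)
      ultimately show "\<exists>g \<in> carrier (free_module K X).
          g \<oplus>\<^bsub>free_module K X\<^esub> f = \<zero>\<^bsub>free_module K X\<^esub>"
        by metis
    qed (auto simp: carrier_free_module free_module_simps fin_add a_ac)
  qed (auto simp: carrier_free_module free_module_simps fin_smult l_distr r_distr m_assoc
      is_cring)
qed

lemma free_gen_closed:
  assumes "cring K" "x \<in> X"
  shows "free_gen K x \<in> carrier (free_module K X)"
proof -
  interpret cring K by fact
  have "{y. free_gen K x y \<noteq> \<zero>\<^bsub>K\<^esub>} \<subseteq> {x}" by (auto simp: free_gen_def)
  then have "finite {y. free_gen K x y \<noteq> \<zero>\<^bsub>K\<^esub>}" by (rule finite_subset) simp
  then show ?thesis using assms(2) by (auto simp: carrier_free_module free_gen_def)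
qed

text \<open>The free module is spanned by its generators, in the form of an induction rule.\<close>

lemma free_module_induct:
  assumes K: "cring K" and f: "f \<in> carrier (free_module K X)"
    and zero: "Q \<zero>\<^bsub>free_module K X\<^esub>"
    and gen: "\<And>c x. \<lbrakk>c \<in> carrier K; x \<in> X\<rbrakk> \<Longrightarrow> Q (c \<odot>\<^bsub>free_module K X\<^esub> free_gen K x)"
    and add: "\<And>f g. \<lbrakk>f \<in> carrier (free_module K X); g \<in> carrier (free_module K X); Q f; Q g\<rbrakk>
      \<Longrightarrow> Q (f \<oplus>\<^bsub>free_module K X\<^esub> g)"
  shows "Q f"
proof -
  interpret cring K by fact
  interpret F: module K "free_module K X" by (rule free_module_is_module[OF K])
  have "Q f" if "finite S" "{x. f x \<noteq> \<zero>\<^bsub>K\<^esub>} \<subseteq> S" "f \<in> carrier (free_module K X)" for f S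
    using that
  proof (induction S arbitrary: f)
    case empty
    then have "f = \<zero>\<^bsub>free_module K X\<^esub>" by (auto simp: free_module_simps)
    then show ?case using zero by simp
  next
    case (insert x S)
    let ?g = "f(x := \<zero>\<^bsub>K\<^esub>)"
    show ?case
    proof (cases "f x = \<zero>\<^bsub>K\<^esub>")
      case True
      then show ?thesis using insert by blast
    next
      case False
      then have x: "x \<in> X" using insert.prems by (auto simp: carrier_free_module)
      have fx: "f x \<in> carrier K" using insert.prems by (auto simp: carrier_free_module)
      have fin: "finite {y. ?g y \<noteq> \<zero>\<^bsub>K\<^esub>}"
        by (rule finite_subset[of _ S]) (use insert in auto)
      have g: "?g \<in> carrier (free_module K X)"
        using insert.prems fin by (auto simp: carrier_free_module)
      have "f = ?g \<oplus>\<^bsub>free_module K X\<^esub> (f x \<odot>\<^bsub>free_module K X\<^esub> free_gen K x)"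
        using insert.prems fx by (auto simp: free_module_simps free_gen_def carrier_free_module)
      moreover have "Q ?g" by (rule insert.IH[OF _ g]) (use insert.prems in auto)
      ultimately show ?thesis
        using add[OF g _ _ gen[OF fx x]] fx free_gen_closed[OF K x]
        by (metis F.smult_closed)
    qed
  qed
  then show ?thesis using f by (auto simp: carrier_free_module)
qed

text \<open>The linear extension of a map defined on the generators.\<close>

definition free_lift ::
    "('k, 'm) ring_scheme \<Rightarrow> ('k, 'p) module \<Rightarrow> ('x \<Rightarrow> 'p) \<Rightarrow> ('x \<Rightarrow> 'k) \<Rightarrow> 'p"
  where "free_lift K P c f = (\<Oplus>\<^bsub>P\<^esub>x\<in>{x. f x \<noteq> \<zero>\<^bsub>K\<^esub>}. f x \<odot>\<^bsub>P\<^esub> c x)"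

lemma free_lift_superset:
  assumes P: "module K P" and c: "\<And>x. x \<in> X \<Longrightarrow> c x \<in> carrier P"
    and f: "f \<in> carrier (free_module K X)"
    and S: "finite S" "{x. f x \<noteq> \<zero>\<^bsub>K\<^esub>} \<subseteq> S" "S \<subseteq> X"
  shows "free_lift K P c f = (\<Oplus>\<^bsub>P\<^esub>x\<in>S. f x \<odot>\<^bsub>P\<^esub> c x)"
proof -
  interpret P: module K P by fact
  show ?thesis
    unfolding free_lift_def
  proof (rule P.add.finprod_mono_neutral_cong_left)
    show "(\<lambda>x. f x \<odot>\<^bsub>P\<^esub> c x) \<in> S \<rightarrow> carrier P"
      using f c S by (auto simp: carrier_free_module)
  qed (use S c in auto)
qed

lemma free_lift_linear:
  assumes P: "module K P" and c: "\<And>x. x \<in> X \<Longrightarrow> c x \<in> carrier P"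
  shows "free_lift K P c \<in> linear_maps K (free_module K X) P"
proof -
  interpret P: module K P by fact
  interpret F: module K "free_module K X" by (rule free_module_is_module) (rule P.is_cring)
  let ?F = "free_module K X"
  have supp: "{x. f x \<noteq> \<zero>\<^bsub>K\<^esub>} \<subseteq> X" "finite {x. f x \<noteq> \<zero>\<^bsub>K\<^esub>}" "\<And>x. f x \<in> carrier K"
    if "f \<in> carrier ?F" for f
    using that by (auto simp: carrier_free_module)
  show ?thesis
  proof (rule linear_mapsI)
    fix f assume f: "f \<in> carrier ?F"
    show "free_lift K P c f \<in> carrier P"
      unfolding free_lift_def
      using supp[OF f] c by (intro P.finsum_closed) (auto simp: Pi_iff)
  next
    fix f g assume f: "f \<in> carrier ?F" and g: "g \<in> carrier ?F"
    let ?S = "{x. f x \<noteq> \<zero>\<^bsub>K\<^esub>} \<union> {x. g x \<noteq> \<zero>\<^bsub>K\<^esub>}"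
    have S: "finite ?S" "?S \<subseteq> X" using supp[OF f] supp[OF g] by auto
    have fc: "(\<lambda>x. f x \<odot>\<^bsub>P\<^esub> c x) \<in> ?S \<rightarrow> carrier P" "(\<lambda>x. g x \<odot>\<^bsub>P\<^esub> c x) \<in> ?S \<rightarrow> carrier P"
      using supp[OF f] supp[OF g] c by auto
    have "free_lift K P c (f \<oplus>\<^bsub>?F\<^esub> g) = (\<Oplus>\<^bsub>P\<^esub>x\<in>?S. (f \<oplus>\<^bsub>?F\<^esub> g) x \<odot>\<^bsub>P\<^esub> c x)"
      by (rule free_lift_superset[OF P c F.a_closed[OF f g]])
         (use S in \<open>auto simp: free_module_simps(1)\<close>)
    also have "\<dots> = (\<Oplus>\<^bsub>P\<^esub>x\<in>?S. f x \<odot>\<^bsub>P\<^esub> c x \<oplus>\<^bsub>P\<^esub> g x \<odot>\<^bsub>P\<^esub> c x)"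
      by (rule P.finsum_cong')
         (use supp[OF f] supp[OF g] c in \<open>auto simp: free_module_simps P.smult_l_distr subsetD\<close>)
    also have "\<dots> = (\<Oplus>\<^bsub>P\<^esub>x\<in>?S. f x \<odot>\<^bsub>P\<^esub> c x) \<oplus>\<^bsub>P\<^esub> (\<Oplus>\<^bsub>P\<^esub>x\<in>?S. g x \<odot>\<^bsub>P\<^esub> c x)"
      using fc by (rule P.finsum_addf)
    also have "(\<Oplus>\<^bsub>P\<^esub>x\<in>?S. f x \<odot>\<^bsub>P\<^esub> c x) = free_lift K P c f"
      by (rule free_lift_superset[OF P c, symmetric]) (use S f in auto)
    also have "(\<Oplus>\<^bsub>P\<^esub>x\<in>?S. g x \<odot>\<^bsub>P\<^esub> c x) = free_lift K P c g"
      by (rule free_lift_superset[OF P c, symmetric]) (use S g in auto)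
    finally show "free_lift K P c (f \<oplus>\<^bsub>?F\<^esub> g) = free_lift K P c f \<oplus>\<^bsub>P\<^esub> free_lift K P c g" .
  next
    fix a f assume a: "a \<in> carrier K" and f: "f \<in> carrier ?F"
    let ?S = "{x. f x \<noteq> \<zero>\<^bsub>K\<^esub>}"
    have "free_lift K P c (a \<odot>\<^bsub>?F\<^esub> f) = (\<Oplus>\<^bsub>P\<^esub>x\<in>?S. (a \<odot>\<^bsub>?F\<^esub> f) x \<odot>\<^bsub>P\<^esub> c x)"
      by (rule free_lift_superset[OF P c F.smult_closed[OF a f]])
         (use supp[OF f] a in \<open>auto simp: free_module_simps(3)\<close>)
    also have "\<dots> = (\<Oplus>\<^bsub>P\<^esub>x\<in>?S. a \<odot>\<^bsub>P\<^esub> (f x \<odot>\<^bsub>P\<^esub> c x))"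
      by (rule P.finsum_cong')
         (use supp[OF f] c a in \<open>auto simp: free_module_simps P.smult_assoc1 subsetD\<close>)
    also have "\<dots> = a \<odot>\<^bsub>P\<^esub> free_lift K P c f"
      unfolding free_lift_def
      by (rule P.finsum_smult_ldistr[symmetric]) (use supp[OF f] c a in auto)
    finally show "free_lift K P c (a \<odot>\<^bsub>?F\<^esub> f) = a \<odot>\<^bsub>P\<^esub> free_lift K P c f" .
  qed
qed

lemma free_lift_gen:
  assumes P: "module K P" and c: "\<And>x. x \<in> X \<Longrightarrow> c x \<in> carrier P" and x: "x \<in> X"
  shows "free_lift K P c (free_gen K x) = c x"
proof -
  interpret P: module K P by fact
  have "free_lift K P c (free_gen K x) = (\<Oplus>\<^bsub>P\<^esub>y\<in>{x}. free_gen K x y \<odot>\<^bsub>P\<^esub> c y)"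
    by (rule free_lift_superset[OF P c free_gen_closed[OF P.is_cring x]])
       (use x in \<open>auto simp: free_gen_def\<close>)
  also have "\<dots> = c x"
    using c[OF x] by (subst P.finsum_insert) (auto simp: free_gen_def)
  finally show ?thesis .
qed


section \<open>Quotient modules\<close>

lemma submodule_span_submodule:
  assumes V: "module K V" and G: "G \<subseteq> carrier V"
  shows "submodule (submodule_span K V G) K V"
proof -
  interpret V: module K V by fact
  have ne: "\<exists>N. submodule N K V \<and> G \<subseteq> N" using V.carrier_is_submodule G by blast
  show ?thesis
  proof (rule V.submoduleI)
    show "submodule_span K V G \<subseteq> carrier V"
      using V.carrier_is_submodule G by (auto simp: submodule_span_def)
    show "\<zero>\<^bsub>V\<^esub> \<in> submodule_span K V G"
      using subgroup.one_closed[OF submodule.axioms(1)] by (fastforce simp: submodule_span_def)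
  qed (auto simp: submodule_span_def V.submoduleE)
qed

lemma submodule_span_minimal:
  "\<lbrakk>submodule N K V; G \<subseteq> N\<rbrakk> \<Longrightarrow> submodule_span K V G \<subseteq> N"
  by (auto simp: submodule_span_def)

lemma submodule_span_superset: "G \<subseteq> submodule_span K V G"
  by (auto simp: submodule_span_def)

context
  fixes K :: "('k, 'm) ring_scheme" and V :: "('k, 'v) module" and N
  assumes V: "module K V" and N: "submodule N K V"
begin

interpretation V: module K V by (rule V)
interpretation N: abelian_subgroup N V
  using submodule.axioms(1)[OF N] V.abelian_group_axioms
  by (intro abelian_subgroupI3 additive_subgroup.intro)

text \<open>Scalar multiplication on the quotient is a union over representatives; all of them give the
  same coset.\<close>

lemma coset_smult:
  assumes c: "c \<in> carrier K" and x: "x \<in> carrier V"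
  shows "(\<Union>y\<in>N +>\<^bsub>V\<^esub> x. N +>\<^bsub>V\<^esub> (c \<odot>\<^bsub>V\<^esub> y)) = N +>\<^bsub>V\<^esub> (c \<odot>\<^bsub>V\<^esub> x)"
proof -
  have "N +>\<^bsub>V\<^esub> (c \<odot>\<^bsub>V\<^esub> y) = N +>\<^bsub>V\<^esub> (c \<odot>\<^bsub>V\<^esub> x)" if y: "y \<in> N +>\<^bsub>V\<^esub> x" for y
  proof -
    obtain n where n: "n \<in> N" "y = n \<oplus>\<^bsub>V\<^esub> x" using y by (auto simp: a_r_coset_def')
    have nV: "n \<in> carrier V" using n N.a_subset by auto
    have cn: "c \<odot>\<^bsub>V\<^esub> n \<in> N" using N c n by (intro submodule.smult_closed)
    have "c \<odot>\<^bsub>V\<^esub> y = c \<odot>\<^bsub>V\<^esub> n \<oplus>\<^bsub>V\<^esub> c \<odot>\<^bsub>V\<^esub> x" using n nV c x by (simp add: V.smult_r_distr)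
    then have "c \<odot>\<^bsub>V\<^esub> y \<in> N +>\<^bsub>V\<^esub> (c \<odot>\<^bsub>V\<^esub> x)"
      using cn by (auto simp: a_r_coset_def')
    then show ?thesis
      using V.a_repr_independence[OF _ _ N.a_subgroup] c x by (metis V.smult_closed)
  qed
  moreover have "x \<in> N +>\<^bsub>V\<^esub> x" using x by (rule N.a_rcos_self)
  ultimately show ?thesis by blast
qed

lemma carrier_quotient_module:
  "carrier (quotient_module K V N) = (\<lambda>x. N +>\<^bsub>V\<^esub> x) ` carrier V"
  by (auto simp: quotient_module_def A_RCOSETS_def')

lemma quotient_module_simps:
  assumes "x \<in> carrier V" "y \<in> carrier V"
  shows "(N +>\<^bsub>V\<^esub> x) \<oplus>\<^bsub>quotient_module K V N\<^esub> (N +>\<^bsub>V\<^esub> y) = N +>\<^bsub>V\<^esub> (x \<oplus>\<^bsub>V\<^esub> y)"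
    and "c \<in> carrier K \<Longrightarrow>
      c \<odot>\<^bsub>quotient_module K V N\<^esub> (N +>\<^bsub>V\<^esub> x) = N +>\<^bsub>V\<^esub> (c \<odot>\<^bsub>V\<^esub> x)"
  using assms by (simp_all add: quotient_module_def N.a_rcos_sum coset_smult)

lemma zero_quotient_module: "\<zero>\<^bsub>quotient_module K V N\<^esub> = N +>\<^bsub>V\<^esub> \<zero>\<^bsub>V\<^esub>"
  by (simp add: quotient_module_def N.a_subset)

lemma quotient_module_is_module: "module K (quotient_module K V N)"
proof (rule moduleI)
  show "abelian_group (quotient_module K V N)"
  proof (rule abelian_groupI)
    fix X assume "X \<in> carrier (quotient_module K V N)"
    then obtain x where x: "x \<in> carrier V" "X = N +>\<^bsub>V\<^esub> x" by (auto simp: carrier_quotient_module)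
    then show "\<exists>Y\<in>carrier (quotient_module K V N).
        Y \<oplus>\<^bsub>quotient_module K V N\<^esub> X = \<zero>\<^bsub>quotient_module K V N\<^esub>"
      by (intro bexI[of _ "N +>\<^bsub>V\<^esub> (\<ominus>\<^bsub>V\<^esub> x)"])
         (auto simp: quotient_module_simps carrier_quotient_module zero_quotient_module V.l_neg)
  qed (auto simp: carrier_quotient_module zero_quotient_module quotient_module_simps
      V.a_ac)
qed (auto simp: carrier_quotient_module quotient_module_simps V.smult_l_distr V.smult_r_distr
      V.smult_assoc1 V.is_cring)

lemma coset_linear: "(\<lambda>x. N +>\<^bsub>V\<^esub> x) \<in> linear_maps K V (quotient_module K V N)"
  by (rule linear_mapsI) (auto simp: carrier_quotient_module quotient_module_simps)

lemma coset_eqI: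
  assumes "x \<in> carrier V" "y \<in> carrier V" "x \<ominus>\<^bsub>V\<^esub> y \<in> N"
  shows "N +>\<^bsub>V\<^esub> x = N +>\<^bsub>V\<^esub> y"
proof -
  have "x = (x \<ominus>\<^bsub>V\<^esub> y) \<oplus>\<^bsub>V\<^esub> y" using assms by (simp add: a_minus_def V.a_assoc V.l_neg)
  then have "x \<in> N +>\<^bsub>V\<^esub> y" using assms(3) unfolding a_r_coset_def' by blast
  then show ?thesis using V.a_repr_independence[OF _ _ N.a_subgroup] assms by metis
qed

end


section \<open>The universal property of the tensor product\<close>

lemma module_transfer:
  fixes K :: "('k, 'm) ring_scheme" and V W :: "('k, 'v) module"
  assumes V: "module K V"
    and W: "carrier W = carrier V" "zero W = zero V" "add W = add V" "smult W = smult V"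
  shows "module K W"
proof -
  interpret V: module K V by fact
  have "abelian_group W"
    using V.abelian_group_axioms W unfolding abelian_group_def abelian_monoid_def
      abelian_group_axioms_def by simp
  then show ?thesis
    by (intro moduleI) (simp_all add: W V.is_cring V.smult_l_distr V.smult_r_distr V.smult_assoc1)
qed

lemma carrier_tensor: "carrier (tensor K V W) = carrier (tensor_module K V W)"
  and add_tensor: "add (tensor K V W) = add (tensor_module K V W)"
  and zero_tensor: "zero (tensor K V W) = zero (tensor_module K V W)"
  and smult_tensor: "smult (tensor K V W) = smult (tensor_module K V W)"
  by (simp_all add: tensor_def)

lemma linear_maps_tensor:
  "linear_maps K (tensor_module K V W) P = linear_maps K (tensor K V W) P"
  "linear_maps K P' (tensor_module K V W) = linear_maps K P' (tensor K V W)"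
  by (simp_all add: linear_maps_def carrier_tensor add_tensor smult_tensor)

lemma bilinear_maps_tensor:
  "bilinear_maps K X Y (tensor_module K V W) = bilinear_maps K X Y (tensor K V W)"
  by (simp add: bilinear_maps_def linear_maps_tensor)

lemma tensor_lift_tensor:
  "tensor_lift K (tensor_module K V W) = tensor_lift K (tensor K V W)"
  by (simp add: fun_eq_iff tensor_lift_def finsum_def carrier_tensor add_tensor zero_tensor smult_tensor)

lemma tensor_relators_carrier:
  assumes K: "cring K" and V: "module K V" and W: "module K W"
  shows "tensor_relators K V W \<subseteq> carrier (free_module K (carrier V \<times> carrier W))"
proof -
  interpret F: module K "free_module K (carrier V \<times> carrier W)"
    by (rule free_module_is_module[OF K])
  interpret V: module K V by fact
  interpret W: module K W by fact
  show ?thesis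
    by (auto simp: tensor_relators_def Let_def free_gen_closed[OF K] a_minus_def)
qed

context
  fixes K :: "('k, 'm) ring_scheme" and V :: "('k, 'v) module" and W :: "('k, 'w) module"
  assumes V: "module K V" and W: "module K W"
begin

interpretation V: module K V by (rule V)
interpretation W: module K W by (rule W)

private abbreviation F where "F \<equiv> free_module K (carrier V \<times> carrier W)"
private abbreviation N where "N \<equiv> tensor_null K V W"

private lemma F: "module K F"
  by (rule free_module_is_module[OF V.is_cring])

interpretation F: module K F by (rule F)

private lemma N: "submodule N K F"
  unfolding tensor_null_def
  by (intro submodule_span_submodule F tensor_relators_carrier V.is_cring V W)

lemma tensor_module_is_module: "module K (tensor_module K V W)"
  unfolding tensor_module_def by (rule quotient_module_is_module[OF F N])

private lemma free_gen_pair_closed: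
  "\<lbrakk>v \<in> carrier V; w \<in> carrier W\<rbrakk> \<Longrightarrow> free_gen K (v, w) \<in> carrier F"
  by (simp add: free_gen_closed[OF V.is_cring])

private lemma relators_null: "r \<in> tensor_relators K V W \<Longrightarrow> r \<in> N"
  using submodule_span_superset[of "tensor_relators K V W" K F] by (auto simp: tensor_null_def)

private lemma coset_lin: "(\<lambda>x. N +>\<^bsub>F\<^esub> x) \<in> linear_maps K F (tensor_module K V W)"
  unfolding tensor_module_def by (rule coset_linear[OF F N])

private lemma tens_closed':
  "\<lbrakk>v \<in> carrier V; w \<in> carrier W\<rbrakk> \<Longrightarrow> tens K V W v w \<in> carrier (tensor_module K V W)"
  using linear_closed[OF coset_lin free_gen_pair_closed] by (simp add: tens_def)

private lemma tens_bilinear':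
  "(\<lambda>v w. tens K V W v w) \<in> bilinear_maps K V W (tensor_module K V W)"
proof (intro bilinearI linear_mapsI tens_closed')
  note gen = free_gen_pair_closed F.a_closed F.smult_closed
  fix v v' w assume v: "v \<in> carrier V" "v' \<in> carrier V" "w \<in> carrier W"
  then have "N +>\<^bsub>F\<^esub> free_gen K (v \<oplus>\<^bsub>V\<^esub> v', w) =
      N +>\<^bsub>F\<^esub> (free_gen K (v, w) \<oplus>\<^bsub>F\<^esub> free_gen K (v', w))"
    by (intro coset_eqI[OF F N] relators_null gen) (auto simp: tensor_relators_def Let_def)
  then show "tens K V W (v \<oplus>\<^bsub>V\<^esub> v') w =
      tens K V W v w \<oplus>\<^bsub>tensor_module K V W\<^esub> tens K V W v' w"
    using v by (simp add: tens_def linear_add[OF coset_lin] gen)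
next
  note gen = free_gen_pair_closed F.a_closed F.smult_closed
  fix v w w' assume v: "v \<in> carrier V" "w \<in> carrier W" "w' \<in> carrier W"
  then have "N +>\<^bsub>F\<^esub> free_gen K (v, w \<oplus>\<^bsub>W\<^esub> w') =
      N +>\<^bsub>F\<^esub> (free_gen K (v, w) \<oplus>\<^bsub>F\<^esub> free_gen K (v, w'))"
    by (intro coset_eqI[OF F N] relators_null gen) (auto simp: tensor_relators_def Let_def)
  then show "tens K V W v (w \<oplus>\<^bsub>W\<^esub> w') =
      tens K V W v w \<oplus>\<^bsub>tensor_module K V W\<^esub> tens K V W v w'"
    using v by (simp add: tens_def linear_add[OF coset_lin] gen)
next
  note gen = free_gen_pair_closed F.a_closed F.smult_closed
  fix c v w assume v: "v \<in> carrier V" "w \<in> carrier W" "c \<in> carrier K"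
  then have "N +>\<^bsub>F\<^esub> free_gen K (c \<odot>\<^bsub>V\<^esub> v, w) = N +>\<^bsub>F\<^esub> (c \<odot>\<^bsub>F\<^esub> free_gen K (v, w))"
    by (intro coset_eqI[OF F N] relators_null gen) (auto simp: tensor_relators_def Let_def)
  then show "tens K V W (c \<odot>\<^bsub>V\<^esub> v) w = c \<odot>\<^bsub>tensor_module K V W\<^esub> tens K V W v w"
    using v by (simp add: tens_def linear_smult[OF coset_lin] gen)
  from v have "N +>\<^bsub>F\<^esub> free_gen K (v, c \<odot>\<^bsub>W\<^esub> w) = N +>\<^bsub>F\<^esub> (c \<odot>\<^bsub>F\<^esub> free_gen K (v, w))"
    by (intro coset_eqI[OF F N] relators_null gen) (auto simp: tensor_relators_def Let_def)
  then show "tens K V W v (c \<odot>\<^bsub>W\<^esub> w) = c \<odot>\<^bsub>tensor_module K V W\<^esub> tens K V W v w"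
    using v by (simp add: tens_def linear_smult[OF coset_lin] gen)
qed

private lemma tensor_coset:
  assumes "t \<in> carrier (tensor_module K V W)"
  obtains f where "f \<in> carrier F" "t = N +>\<^bsub>F\<^esub> f"
  using assms by (auto simp: tensor_module_def carrier_quotient_module[OF F N])

text \<open>The relators vanish under the linear extension of a bilinear map, hence so does the whole
  submodule that they span.\<close>

private lemma N_kernel:
  assumes P: "module K P" and b: "b \<in> bilinear_maps K V W P" and n: "n \<in> N"
  shows "free_lift K P (\<lambda>p. b (fst p) (snd p)) n = \<zero>\<^bsub>P\<^esub>" "n \<in> carrier F"
proof -
  interpret P: module K P by fact
  let ?c = "\<lambda>p. b (fst p) (snd p)"
  have c: "\<And>p. p \<in> carrier V \<times> carrier W \<Longrightarrow> ?c p \<in> carrier P"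
    using bilinear_closed[OF b] by auto
  note lin = free_lift_linear[OF P c]
  note bc = bilinear_closed[OF b]
  have gen: "free_lift K P ?c (free_gen K (v, w)) = b v w"
    if "v \<in> carrier V" "w \<in> carrier W" for v w
    using free_lift_gen[OF P c, where x = "(v, w)"] that by simp
  have "N \<subseteq> {x \<in> carrier F. free_lift K P ?c x = \<zero>\<^bsub>P\<^esub>}"
    unfolding tensor_null_def
  proof (rule submodule_span_minimal[OF linear_kernel_submodule[OF F P lin]])
    have "free_lift K P ?c r = \<zero>\<^bsub>P\<^esub>" if "r \<in> tensor_relators K V W" for r
      using that
      by (auto simp: tensor_relators_def Let_def linear_diff[OF F P lin] linear_add[OF lin]
          linear_smult[OF lin] free_gen_pair_closed gen bc P.r_neg a_minus_def[of P]
          linear_add[OF bilinear_left[OF b]] linear_add[OF bilinear_right[OF b]]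
          linear_smult[OF bilinear_left[OF b]] linear_smult[OF bilinear_right[OF b]])
    then show "tensor_relators K V W \<subseteq> {x \<in> carrier F. free_lift K P ?c x = \<zero>\<^bsub>P\<^esub>}"
      using tensor_relators_carrier[OF V.is_cring V W] by auto
  qed simp
  then show "free_lift K P ?c n = \<zero>\<^bsub>P\<^esub>" "n \<in> carrier F" using n by auto
qed

private lemma some_representative:
  assumes f: "f \<in> carrier F"
  shows "\<exists>n\<in>N. (SOME g. g \<in> N +>\<^bsub>F\<^esub> f) = n \<oplus>\<^bsub>F\<^esub> f"
proof -
  have "\<zero>\<^bsub>F\<^esub> \<in> N" using subgroup.one_closed[OF submodule.axioms(1)[OF N]] by simp
  then have "\<exists>g. g \<in> N +>\<^bsub>F\<^esub> f" by (auto simp: a_r_coset_def')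
  then have "(SOME g. g \<in> N +>\<^bsub>F\<^esub> f) \<in> N +>\<^bsub>F\<^esub> f" by (rule someI_ex)
  then show ?thesis by (auto simp: a_r_coset_def')
qed

text \<open>The value of \<open>tensor_lift\<close> does not depend on the representing formal sum that was chosen.\<close>

private lemma tensor_lift_coset:
  assumes P: "module K P" and b: "b \<in> bilinear_maps K V W P" and f: "f \<in> carrier F"
  shows "tensor_lift K P b (N +>\<^bsub>F\<^esub> f) = free_lift K P (\<lambda>p. b (fst p) (snd p)) f"
proof -
  interpret P: module K P by fact
  let ?c = "\<lambda>p. b (fst p) (snd p)"
  have c: "\<And>p. p \<in> carrier V \<times> carrier W \<Longrightarrow> ?c p \<in> carrier P"
    using bilinear_closed[OF b] by auto
  note lin = free_lift_linear[OF P c]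
  obtain n where n: "n \<in> N" "(SOME g. g \<in> N +>\<^bsub>F\<^esub> f) = n \<oplus>\<^bsub>F\<^esub> f"
    using some_representative[OF f] by blast
  have "tensor_lift K P b (N +>\<^bsub>F\<^esub> f) = free_lift K P ?c (n \<oplus>\<^bsub>F\<^esub> f)"
    by (simp add: tensor_lift_def Let_def n free_lift_def)
  also have "\<dots> = free_lift K P ?c n \<oplus>\<^bsub>P\<^esub> free_lift K P ?c f"
    by (rule linear_add[OF lin]) (use N_kernel(2)[OF P b n(1)] f in auto)
  also have "\<dots> = free_lift K P ?c f"
    using N_kernel(1)[OF P b n(1)] linear_closed[OF lin f] by simp
  finally show ?thesis .
qed

private lemma tensor_lift_linear':
  assumes P: "module K P" and b: "b \<in> bilinear_maps K V W P"
  shows "tensor_lift K P b \<in> linear_maps K (tensor_module K V W) P"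
proof -
  let ?c = "\<lambda>p. b (fst p) (snd p)"
  have c: "\<And>p. p \<in> carrier V \<times> carrier W \<Longrightarrow> ?c p \<in> carrier P"
    using bilinear_closed[OF b] by auto
  note lin = free_lift_linear[OF P c]
  note cos = tensor_lift_coset[OF P b]
  show ?thesis
  proof (rule linear_mapsI)
    fix s t assume "s \<in> carrier (tensor_module K V W)" "t \<in> carrier (tensor_module K V W)"
    then obtain f g where f: "f \<in> carrier F" "s = N +>\<^bsub>F\<^esub> f"
      and g: "g \<in> carrier F" "t = N +>\<^bsub>F\<^esub> g" by (metis tensor_coset)
    show "tensor_lift K P b s \<in> carrier P"
      using f by (simp add: cos linear_closed[OF lin])
    show "tensor_lift K P b (s \<oplus>\<^bsub>tensor_module K V W\<^esub> t) =
        tensor_lift K P b s \<oplus>\<^bsub>P\<^esub> tensor_lift K P b t"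
      using f g by (simp add: cos linear_add[OF lin] linear_add[OF coset_lin, symmetric])
    fix a assume "a \<in> carrier K"
    then show "tensor_lift K P b (a \<odot>\<^bsub>tensor_module K V W\<^esub> s) = a \<odot>\<^bsub>P\<^esub> tensor_lift K P b s"
      using f by (simp add: cos linear_smult[OF lin] linear_smult[OF coset_lin, symmetric])
  qed
qed

lemma tensor_lift_tens:
  assumes P: "module K P" and b: "b \<in> bilinear_maps K V W P"
    and v: "v \<in> carrier V" and w: "w \<in> carrier W"
  shows "tensor_lift K P b (tens K V W v w) = b v w"
proof -
  have "free_lift K P (\<lambda>p. b (fst p) (snd p)) (free_gen K (v, w)) = b (fst (v, w)) (snd (v, w))"
    by (rule free_lift_gen[OF P, of "carrier V \<times> carrier W"]) (use bilinear_closed[OF b] v w in auto)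
  then show ?thesis
    using v w by (simp add: tens_def tensor_lift_coset[OF P b] free_gen_pair_closed)
qed

private lemma tensor_ext':
  assumes P: "module K P" and f: "f \<in> linear_maps K (tensor_module K V W) P"
    and g: "g \<in> linear_maps K (tensor_module K V W) P"
    and eq: "\<And>v w. \<lbrakk>v \<in> carrier V; w \<in> carrier W\<rbrakk> \<Longrightarrow> f (tens K V W v w) = g (tens K V W v w)"
    and t: "t \<in> carrier (tensor_module K V W)"
  shows "f t = g t"
proof -
  note T = tensor_module_is_module
  obtain x where x: "x \<in> carrier F" "t = N +>\<^bsub>F\<^esub> x" using tensor_coset[OF t] .
  have "f (N +>\<^bsub>F\<^esub> x) = g (N +>\<^bsub>F\<^esub> x)"
  proof (rule free_module_induct[OF V.is_cring x(1)])
    show "f (N +>\<^bsub>F\<^esub> \<zero>\<^bsub>F\<^esub>) = g (N +>\<^bsub>F\<^esub> \<zero>\<^bsub>F\<^esub>)"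
      by (simp add: linear_zero[OF F T coset_lin] linear_zero[OF T P f] linear_zero[OF T P g])
  next
    fix c p assume c: "c \<in> carrier K" and p: "p \<in> carrier V \<times> carrier W"
    then obtain v w where vw: "p = (v, w)" "v \<in> carrier V" "w \<in> carrier W" by auto
    show "f (N +>\<^bsub>F\<^esub> (c \<odot>\<^bsub>F\<^esub> free_gen K p)) = g (N +>\<^bsub>F\<^esub> (c \<odot>\<^bsub>F\<^esub> free_gen K p))"
      using c vw eq tens_closed'
      by (simp add: linear_smult[OF coset_lin] free_gen_pair_closed linear_smult[OF f]
          linear_smult[OF g] flip: tens_def)
  next
    fix y z assume "y \<in> carrier F" "z \<in> carrier F"
      "f (N +>\<^bsub>F\<^esub> y) = g (N +>\<^bsub>F\<^esub> y)" "f (N +>\<^bsub>F\<^esub> z) = g (N +>\<^bsub>F\<^esub> z)"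
    then show "f (N +>\<^bsub>F\<^esub> (y \<oplus>\<^bsub>F\<^esub> z)) = g (N +>\<^bsub>F\<^esub> (y \<oplus>\<^bsub>F\<^esub> z))"
      by (simp add: linear_add[OF coset_lin] linear_closed[OF coset_lin] linear_add[OF f]
          linear_add[OF g])
  qed
  then show ?thesis using x by simp
qed

private lemma tensor_support':
  assumes t: "t \<in> carrier (tensor_module K V W)"
  shows "{p. (SOME f. f \<in> t) p \<noteq> \<zero>\<^bsub>K\<^esub>} \<subseteq> carrier V \<times> carrier W"
proof -
  obtain f where f: "f \<in> carrier F" "t = N +>\<^bsub>F\<^esub> f" using tensor_coset[OF t] .
  obtain n where n: "n \<in> N" "(SOME g. g \<in> t) = n \<oplus>\<^bsub>F\<^esub> f"
    using some_representative[OF f(1)] f(2) by blast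
  have "n \<in> carrier F" using F.submoduleE(1)[OF N] n by auto
  then have "(SOME g. g \<in> t) \<in> carrier F" using f n by simp
  then show ?thesis by (auto simp: carrier_free_module)
qed

text \<open>The records \<open>tensor\<close> and \<open>tensor_module\<close> differ only in \<open>mult\<close> and \<open>one\<close>, so the universal
  property carries over.\<close>

lemma tensor_is_module: "module K (tensor K V W)"
  by (rule module_transfer[OF tensor_module_is_module])
     (simp_all add: carrier_tensor add_tensor zero_tensor smult_tensor)

lemmas tens_bilinear = tens_bilinear'[unfolded bilinear_maps_tensor]
lemmas tens_closed = tens_closed'[folded carrier_tensor]
lemmas tensor_lift_linear = tensor_lift_linear'[unfolded linear_maps_tensor]
lemmas tensor_ext = tensor_ext'[unfolded linear_maps_tensor, folded carrier_tensor]
lemmas tensor_support = tensor_support'[folded carrier_tensor]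

end

lemma foldSetD_cong:
  assumes "(A, x) \<in> foldSetD D f e" "\<And>a. a \<in> A \<Longrightarrow> f a = g a"
  shows "(A, x) \<in> foldSetD D g e"
  using assms by (induction rule: foldSetD.induct) (auto intro: foldSetD.intros)

text \<open>The summands need not lie in the carrier: a finite sum only evaluates them on the index set.
  Consequently Sweedler sums can be rewritten termwise without any bilinearity condition.\<close>

lemma finsum_cong_any:
  assumes "\<And>a. a \<in> A \<Longrightarrow> f a = g a"
  shows "finsum P f A = finsum P g A"
proof -
  have "(A, x) \<in> foldSetD D (add P \<circ> f) e \<longleftrightarrow> (A, x) \<in> foldSetD D (add P \<circ> g) e" for D x e
    using foldSetD_cong[of A x D "add P \<circ> f" e "add P \<circ> g"]
      foldSetD_cong[of A x D "add P \<circ> g" e "add P \<circ> f"] assms by auto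
  then show ?thesis by (simp add: finsum_def finprod_def foldD_def)
qed

lemma tensor_lift_cong:
  assumes "module K V" "module K W" "t \<in> carrier (tensor K V W)"
    and "\<And>v w. \<lbrakk>v \<in> carrier V; w \<in> carrier W\<rbrakk> \<Longrightarrow> b v w = b' v w"
  shows "tensor_lift K P b t = tensor_lift K P b' t"
  unfolding tensor_lift_def Let_def
  by (rule finsum_cong_any) (use tensor_support[OF assms(1-3)] assms(4) in force)


section \<open>Calculus with lifted bilinear maps\<close>

lemma linear_pointwise_add:
  assumes P: "module K P" and f: "f \<in> linear_maps K V P" and g: "g \<in> linear_maps K V P"
    and V: "module K V"
  shows "(\<lambda>x. f x \<oplus>\<^bsub>P\<^esub> g x) \<in> linear_maps K V P"
proof -
  interpret P: module K P by fact
  show ?thesis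
    by (rule linear_mapsI)
      (auto simp: linear_add[OF f] linear_add[OF g] linear_smult[OF f] linear_smult[OF g]
        linear_closed[OF f] linear_closed[OF g] P.smult_r_distr P.a_ac)
qed

lemma linear_pointwise_smult:
  assumes P: "module K P" and f: "f \<in> linear_maps K V P" and c: "c \<in> carrier K"
  shows "(\<lambda>x. c \<odot>\<^bsub>P\<^esub> f x) \<in> linear_maps K V P"
proof -
  interpret P: module K P by fact
  show ?thesis
    by (rule linear_mapsI)
      (auto simp: linear_add[OF f] linear_smult[OF f] linear_closed[OF f] P.smult_r_distr c
        P.R.m_comm[of c] simp flip: P.smult_assoc1)
qed

lemma linear_bilinear_left:
  assumes "b \<in> bilinear_maps K V W P" "f \<in> linear_maps K X V" "w \<in> carrier W"
  shows "(\<lambda>x. b (f x) w) \<in> linear_maps K X P"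
  by (rule linear_compose[OF bilinear_left assms(2)]) (use assms in auto)

lemma linear_bilinear_right:
  assumes "b \<in> bilinear_maps K V W P" "f \<in> linear_maps K X W" "v \<in> carrier V"
  shows "(\<lambda>x. b v (f x)) \<in> linear_maps K X P"
  by (rule linear_compose[OF bilinear_right assms(2)]) (use assms in auto)

lemma linear_tensor_lift_arg:
  assumes "module K V" "module K W" "module K P"
    and "b \<in> bilinear_maps K V W P" "f \<in> linear_maps K X (tensor K V W)"
  shows "(\<lambda>x. tensor_lift K P b (f x)) \<in> linear_maps K X P"
  by (rule linear_compose[OF tensor_lift_linear]) (use assms in auto)

lemma tensor_lift_closed:
  assumes "module K V" "module K W" "module K P"
    and "b \<in> bilinear_maps K V W P" "t \<in> carrier (tensor K V W)"
  shows "tensor_lift K P b t \<in> carrier P"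
  by (rule linear_closed[OF tensor_lift_linear]) (use assms in auto)

text \<open>A Sweedler sum over a fixed tensor is linear in any parameter on which its summand depends
  linearly.\<close>

lemma linear_tensor_lift_param:
  assumes V: "module K V" and W: "module K W" and P: "module K P" and X: "module K X"
    and t: "t \<in> carrier (tensor K V W)"
    and b: "\<And>x. x \<in> carrier X \<Longrightarrow> b x \<in> bilinear_maps K V W P"
    and lin: "\<And>v w. \<lbrakk>v \<in> carrier V; w \<in> carrier W\<rbrakk> \<Longrightarrow> (\<lambda>x. b x v w) \<in> linear_maps K X P"
  shows "(\<lambda>x. tensor_lift K P (b x) t) \<in> linear_maps K X P"
proof (rule linear_mapsI)
  interpret X: module K X by fact
  note L = tensor_lift_linear[OF V W P] and T = tensor_is_module[OF V W]
    and ev = tensor_lift_tens[OF V W P]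
  fix x y assume x: "x \<in> carrier X" and y: "y \<in> carrier X"
  have xy: "x \<oplus>\<^bsub>X\<^esub> y \<in> carrier X" using x y by simp
  show "tensor_lift K P (b x) t \<in> carrier P"
    by (rule tensor_lift_closed[OF V W P b[OF x] t])
  show "tensor_lift K P (b (x \<oplus>\<^bsub>X\<^esub> y)) t = tensor_lift K P (b x) t \<oplus>\<^bsub>P\<^esub> tensor_lift K P (b y) t"
    by (rule tensor_ext[OF V W P L[OF b[OF xy]]
          linear_pointwise_add[OF P L[OF b[OF x]] L[OF b[OF y]] T] _ t])
       (simp add: ev b x y linear_add[OF lin])
next
  interpret X: module K X by fact
  note L = tensor_lift_linear[OF V W P] and T = tensor_is_module[OF V W]
    and ev = tensor_lift_tens[OF V W P]
  fix c x assume c: "c \<in> carrier K" and x: "x \<in> carrier X"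
  have cx: "c \<odot>\<^bsub>X\<^esub> x \<in> carrier X" using c x by simp
  show "tensor_lift K P (b (c \<odot>\<^bsub>X\<^esub> x)) t = c \<odot>\<^bsub>P\<^esub> tensor_lift K P (b x) t"
    by (rule tensor_ext[OF V W P L[OF b[OF cx]]
          linear_pointwise_smult[OF P L[OF b[OF x]] c] _ t])
       (simp add: ev b c x linear_smult[OF lin])
qed

text \<open>Linear maps commute with Sweedler sums.\<close>

lemma linear_tensor_lift:
  assumes V: "module K V" and W: "module K W" and P: "module K P" and Q: "module K Q"
    and f: "f \<in> linear_maps K P Q" and b: "b \<in> bilinear_maps K V W P"
    and t: "t \<in> carrier (tensor K V W)"
  shows "f (tensor_lift K P b t) = tensor_lift K Q (\<lambda>v w. f (b v w)) t"
proof -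
  have fb: "(\<lambda>v w. f (b v w)) \<in> bilinear_maps K V W Q"
    by (intro bilinearI linear_compose[OF f] bilinear_left[OF b] bilinear_right[OF b])
  show ?thesis
    by (rule tensor_ext[OF V W Q linear_compose[OF f tensor_lift_linear[OF V W P b]]
          tensor_lift_linear[OF V W Q fb] _ t])
       (simp add: tensor_lift_tens[OF V W P b] tensor_lift_tens[OF V W Q fb])
qed

text \<open>Fubini's rule for nested Sweedler sums.\<close>

lemma tensor_lift_swap:
  assumes V: "module K V" and W: "module K W" and X: "module K X" and Y: "module K Y"
    and P: "module K P"
    and s: "s \<in> carrier (tensor K V W)" and t: "t \<in> carrier (tensor K X Y)"
    and b1: "\<And>v w. \<lbrakk>v \<in> carrier V; w \<in> carrier W\<rbrakk> \<Longrightarrow> b v w \<in> bilinear_maps K X Y P"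
    and b2: "\<And>x y. \<lbrakk>x \<in> carrier X; y \<in> carrier Y\<rbrakk> \<Longrightarrow>
      (\<lambda>v w. b v w x y) \<in> bilinear_maps K V W P"
  shows "tensor_lift K P (\<lambda>v w. tensor_lift K P (b v w) t) s =
    tensor_lift K P (\<lambda>x y. tensor_lift K P (\<lambda>v w. b v w x y) s) t"
proof (rule tensor_ext[OF V W P _ _ _ s])
  have b12: "(\<lambda>v w. tensor_lift K P (b v w) t) \<in> bilinear_maps K V W P"
    by (intro bilinearI linear_tensor_lift_param[OF X Y P _ t] V W b1 bilinear_left[OF b2]
        bilinear_right[OF b2])
  then show "tensor_lift K P (\<lambda>v w. tensor_lift K P (b v w) t) \<in> linear_maps K (tensor K V W) P"
    by (rule tensor_lift_linear[OF V W P])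
  have "(\<lambda>x y. tensor_lift K P (\<lambda>v w. b v w x y) r) \<in> bilinear_maps K X Y P"
    if "r \<in> carrier (tensor K V W)" for r
    by (intro bilinearI linear_tensor_lift_param[OF V W P _ that] X Y b2 bilinear_left[OF b1]
        bilinear_right[OF b1])
  then show "(\<lambda>s. tensor_lift K P (\<lambda>x y. tensor_lift K P (\<lambda>v w. b v w x y) s) t)
      \<in> linear_maps K (tensor K V W) P"
    by (intro linear_tensor_lift_param[OF X Y P tensor_is_module[OF V W] t]
        tensor_lift_linear[OF V W P b2])
  fix v w assume v: "v \<in> carrier V" and w: "w \<in> carrier W"
  show "tensor_lift K P (\<lambda>v w. tensor_lift K P (b v w) t) (tens K V W v w) =
      tensor_lift K P (\<lambda>x y. tensor_lift K P (\<lambda>v w. b v w x y) (tens K V W v w)) t"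
    by (simp add: tensor_lift_tens[OF V W P b12 v w])
       (rule tensor_lift_cong[OF X Y t], simp add: tensor_lift_tens[OF V W P b2 v w])
qed


section \<open>Threefold tensor products and products of tensors\<close>

text \<open>Maps that are linear in each of three arguments, the other two being fixed in the carriers.\<close>

definition trilinear_maps ::
    "('k, 'm) ring_scheme \<Rightarrow> ('k, 'u) module \<Rightarrow> ('k, 'v) module \<Rightarrow> ('k, 'w) module \<Rightarrow>
     ('k, 'p) module \<Rightarrow> ('u \<Rightarrow> 'v \<Rightarrow> 'w \<Rightarrow> 'p) set"
  where "trilinear_maps K U V W P =
    {G. (\<forall>v\<in>carrier V. \<forall>w\<in>carrier W. (\<lambda>u. G u v w) \<in> linear_maps K U P) \<and>
        (\<forall>u\<in>carrier U. \<forall>w\<in>carrier W. (\<lambda>v. G u v w) \<in> linear_maps K V P) \<and>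
        (\<forall>u\<in>carrier U. \<forall>v\<in>carrier V. (\<lambda>w. G u v w) \<in> linear_maps K W P)}"

lemma trilinearI:
  assumes "\<And>v w. \<lbrakk>v \<in> carrier V; w \<in> carrier W\<rbrakk> \<Longrightarrow> (\<lambda>u. G u v w) \<in> linear_maps K U P"
    and "\<And>u w. \<lbrakk>u \<in> carrier U; w \<in> carrier W\<rbrakk> \<Longrightarrow> (\<lambda>v. G u v w) \<in> linear_maps K V P"
    and "\<And>u v. \<lbrakk>u \<in> carrier U; v \<in> carrier V\<rbrakk> \<Longrightarrow> (\<lambda>w. G u v w) \<in> linear_maps K W P"
  shows "(\<lambda>u v w. G u v w) \<in> trilinear_maps K U V W P"
  using assms by (simp add: trilinear_maps_def)

lemma linear_trilinear:
  assumes "G \<in> trilinear_maps K U V W P"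
  shows "\<lbrakk>f \<in> linear_maps K X U; v \<in> carrier V; w \<in> carrier W\<rbrakk> \<Longrightarrow>
      (\<lambda>x. G (f x) v w) \<in> linear_maps K X P"
    and "\<lbrakk>u \<in> carrier U; f' \<in> linear_maps K X V; w \<in> carrier W\<rbrakk> \<Longrightarrow>
      (\<lambda>x. G u (f' x) w) \<in> linear_maps K X P"
    and "\<lbrakk>u \<in> carrier U; v \<in> carrier V; f'' \<in> linear_maps K X W\<rbrakk> \<Longrightarrow>
      (\<lambda>x. G u v (f'' x)) \<in> linear_maps K X P"
  using assms linear_compose[of "\<lambda>u. G u v w" K U P f X] linear_compose[of "\<lambda>v. G u v w" K V P f' X]
    linear_compose[of "\<lambda>w. G u v w" K W P f'' X]
  by (auto simp: trilinear_maps_def)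

lemma trilinear_bilinear:
  assumes "G \<in> trilinear_maps K U V W P"
  shows "w \<in> carrier W \<Longrightarrow> (\<lambda>u v. G u v w) \<in> bilinear_maps K U V P"
    and "v \<in> carrier V \<Longrightarrow> (\<lambda>u w. G u v w) \<in> bilinear_maps K U W P"
    and "u \<in> carrier U \<Longrightarrow> (\<lambda>v w. G u v w) \<in> bilinear_maps K V W P"
  using assms by (auto simp: bilinear_maps_def trilinear_maps_def)

text \<open>A trilinear map extends to \<open>U \<otimes> (V \<otimes> W)\<close> and to \<open>(U \<otimes> V) \<otimes> W\<close> by two nested lifts, the
  first one over the inner tensor product.\<close>

lemma trilinear_lift_right_bilinear:
  assumes U: "module K U" and V: "module K V" and W: "module K W" and P: "module K P"
    and G: "G \<in> trilinear_maps K U V W P"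
  shows "(\<lambda>u t. tensor_lift K P (\<lambda>v w. G u v w) t) \<in> bilinear_maps K U (tensor K V W) P"
  by (intro bilinearI linear_tensor_lift_param[OF V W P U] tensor_lift_linear[OF V W P]
      trilinear_bilinear[OF G] linear_trilinear[OF G] linear_ident)

lemma trilinear_lift_left_bilinear:
  assumes U: "module K U" and V: "module K V" and W: "module K W" and P: "module K P"
    and G: "G \<in> trilinear_maps K U V W P"
  shows "(\<lambda>t w. tensor_lift K P (\<lambda>u v. G u v w) t) \<in> bilinear_maps K (tensor K U V) W P"
  by (intro bilinearI linear_tensor_lift_param[OF U V P W] tensor_lift_linear[OF U V P]
      trilinear_bilinear[OF G] linear_trilinear[OF G] linear_ident)

lemma tensor_map_bilinear:
  assumes V: "module K V" and W: "module K W"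
    and f: "f \<in> linear_maps K X V" and g: "g \<in> linear_maps K Y W"
  shows "(\<lambda>x y. tens K V W (f x) (g y)) \<in> bilinear_maps K X Y (tensor K V W)"
  by (intro bilinearI linear_bilinear_left[OF tens_bilinear[OF V W] f]
      linear_bilinear_right[OF tens_bilinear[OF V W] g] linear_closed[OF f] linear_closed[OF g])

lemma tensor_map_closed:
  assumes "module K V" "module K W" "module K X" "module K Y"
    and "f \<in> linear_maps K X V" "g \<in> linear_maps K Y W" "t \<in> carrier (tensor K X Y)"
  shows "tensor_map K V W f g t \<in> carrier (tensor K V W)"
  unfolding tensor_map_def
  by (rule tensor_lift_closed[OF _ _ _ tensor_map_bilinear]) (use assms tensor_is_module in auto)

lemma tensor_lift_map:
  assumes V: "module K V" and W: "module K W" and X: "module K X" and Y: "module K Y"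
    and P: "module K P"
    and f: "f \<in> linear_maps K X V" and g: "g \<in> linear_maps K Y W"
    and b: "b \<in> bilinear_maps K V W P" and t: "t \<in> carrier (tensor K X Y)"
  shows "tensor_lift K P b (tensor_map K V W f g t) = tensor_lift K P (\<lambda>x y. b (f x) (g y)) t"
proof -
  have "tensor_lift K P b (tensor_map K V W f g t) =
      tensor_lift K P (\<lambda>x y. tensor_lift K P b (tens K V W (f x) (g y))) t"
    unfolding tensor_map_def
    by (rule linear_tensor_lift[OF X Y tensor_is_module[OF V W] P tensor_lift_linear[OF V W P b]
          tensor_map_bilinear[OF V W f g] t])
  also have "\<dots> = tensor_lift K P (\<lambda>x y. b (f x) (g y)) t"
    by (rule tensor_lift_cong[OF X Y t])
       (simp add: tensor_lift_tens[OF V W P b] linear_closed[OF f] linear_closed[OF g])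
  finally show ?thesis .
qed

lemma tensor_assoc_trilinear:
  assumes U: "module K U" and V: "module K V" and W: "module K W"
  shows "(\<lambda>u v w. tens K U (tensor K V W) u (tens K V W v w))
    \<in> trilinear_maps K U V W (tensor K U (tensor K V W))"
  by (intro trilinearI linear_bilinear_left[OF tens_bilinear] linear_bilinear_right[OF tens_bilinear]
      tensor_is_module tens_closed linear_ident assms)

lemma tensor_assoc_closed:
  assumes U: "module K U" and V: "module K V" and W: "module K W"
    and s: "s \<in> carrier (tensor K (tensor K U V) W)"
  shows "tensor_assoc K U V W s \<in> carrier (tensor K U (tensor K V W))"
  unfolding tensor_assoc_def
  by (rule tensor_lift_closed[OF _ _ _ trilinear_lift_left_bilinear[OF _ _ _ _
        tensor_assoc_trilinear] s]) (intro tensor_is_module U V W)+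

text \<open>The two extensions of a trilinear map agree up to the associator.\<close>

lemma tensor_lift_assoc:
  assumes U: "module K U" and V: "module K V" and W: "module K W" and P: "module K P"
    and G: "G \<in> trilinear_maps K U V W P" and s: "s \<in> carrier (tensor K (tensor K U V) W)"
  shows "tensor_lift K P (\<lambda>u t. tensor_lift K P (\<lambda>v w. G u v w) t) (tensor_assoc K U V W s) =
    tensor_lift K P (\<lambda>t w. tensor_lift K P (\<lambda>u v. G u v w) t) s"
proof -
  let ?T = "tensor K U (tensor K V W)" and ?E = "\<lambda>u v w. tens K U (tensor K V W) u (tens K V W v w)"
  let ?\<phi> = "tensor_lift K P (\<lambda>u t. tensor_lift K P (\<lambda>v w. G u v w) t)"
  note UV = tensor_is_module[OF U V] and VW = tensor_is_module[OF V W]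
  note T = tensor_is_module[OF U VW]
  note b = trilinear_lift_right_bilinear[OF U V W P G]
  note E = tensor_assoc_trilinear[OF U V W]
  note \<phi> = tensor_lift_linear[OF U VW P b]
  have "?\<phi> (tensor_assoc K U V W s) =
      tensor_lift K P (\<lambda>t w. ?\<phi> (tensor_lift K ?T (\<lambda>u v. ?E u v w) t)) s"
    unfolding tensor_assoc_def
    by (rule linear_tensor_lift[OF UV W T P \<phi> trilinear_lift_left_bilinear[OF U V W T E] s])
  also have "\<dots> = tensor_lift K P (\<lambda>t w. tensor_lift K P (\<lambda>u v. G u v w) t) s"
  proof (rule tensor_lift_cong[OF UV W s])
    fix t w assume t: "t \<in> carrier (tensor K U V)" and w: "w \<in> carrier W"
    have "?\<phi> (tensor_lift K ?T (\<lambda>u v. ?E u v w) t) = tensor_lift K P (\<lambda>u v. ?\<phi> (?E u v w)) t"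
      by (rule linear_tensor_lift[OF U V T P \<phi> trilinear_bilinear(1)[OF E w] t])
    also have "\<dots> = tensor_lift K P (\<lambda>u v. G u v w) t"
      by (rule tensor_lift_cong[OF U V t])
         (simp add: tensor_lift_tens[OF U VW P b] tens_closed[OF V W] w
           tensor_lift_tens[OF V W P trilinear_bilinear(3)[OF G]])
    finally show "?\<phi> (tensor_lift K ?T (\<lambda>u v. ?E u v w) t) = tensor_lift K P (\<lambda>u v. G u v w) t" .
  qed
  finally show ?thesis .
qed

text \<open>The product on \<open>V \<otimes> W\<close> induced by bilinear products on the factors; neither associativity nor
  units play a role here, so the lemmas also apply to threefold tensor products.\<close>

context
  fixes K :: "('k, 'm) ring_scheme" and V :: "('k, 'v) module" and W :: "('k, 'w) module"
  assumes V: "module K V" and W: "module K W"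
    and mV: "(\<lambda>x y. x \<otimes>\<^bsub>V\<^esub> y) \<in> bilinear_maps K V V V"
    and mW: "(\<lambda>x y. x \<otimes>\<^bsub>W\<^esub> y) \<in> bilinear_maps K W W W"
begin

private lemmas VW = tensor_is_module[OF V W]
private lemmas intros = linear_bilinear_left[OF mV] linear_bilinear_right[OF mV]
  linear_bilinear_left[OF mW] linear_bilinear_right[OF mW] linear_ident
  bilinear_closed[OF mV] bilinear_closed[OF mW]

private lemma mult_bilinear_left:
  assumes b: "b \<in> bilinear_maps K V W P"
    and v: "v \<in> carrier V" and w: "w \<in> carrier W"
  shows "(\<lambda>v' w'. b (v \<otimes>\<^bsub>V\<^esub> v') (w \<otimes>\<^bsub>W\<^esub> w')) \<in> bilinear_maps K V W P"
  by (intro bilinearI linear_bilinear_left[OF b] linear_bilinear_right[OF b] intros v w)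

private lemma mult_bilinear_right:
  assumes b: "b \<in> bilinear_maps K V W P"
    and v: "v \<in> carrier V" and w: "w \<in> carrier W"
  shows "(\<lambda>v' w'. b (v' \<otimes>\<^bsub>V\<^esub> v) (w' \<otimes>\<^bsub>W\<^esub> w)) \<in> bilinear_maps K V W P"
  by (intro bilinearI linear_bilinear_left[OF b] linear_bilinear_right[OF b] intros v w)

private lemma mult_lift_bilinear:
  assumes P: "module K P" and b: "b \<in> bilinear_maps K V W P"
    and t: "t \<in> carrier (tensor K V W)"
  shows "(\<lambda>v w. tensor_lift K P (\<lambda>v' w'. b (v \<otimes>\<^bsub>V\<^esub> v') (w \<otimes>\<^bsub>W\<^esub> w')) t)
    \<in> bilinear_maps K V W P"
  by (intro bilinearI linear_tensor_lift_param[OF V W P _ t] V W mult_bilinear_left[OF b]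
      linear_bilinear_left[OF b] linear_bilinear_right[OF b] intros)

private lemma tensor_mult_eq:
  "s \<otimes>\<^bsub>tensor K V W\<^esub> t = tensor_lift K (tensor K V W) (\<lambda>v w.
     tensor_lift K (tensor K V W) (\<lambda>v' w'. tens K V W (v \<otimes>\<^bsub>V\<^esub> v') (w \<otimes>\<^bsub>W\<^esub> w')) t) s"
  by (simp add: tensor_lift_tensor[symmetric]) (simp add: tensor_def)

lemma tensor_mult_bilinear:
  "(\<lambda>s t. s \<otimes>\<^bsub>tensor K V W\<^esub> t)
     \<in> bilinear_maps K (tensor K V W) (tensor K V W) (tensor K V W)"
  unfolding tensor_mult_eq
proof (intro bilinearI)
  note tb = tens_bilinear[OF V W]
  fix t assume t: "t \<in> carrier (tensor K V W)"
  show "(\<lambda>s. tensor_lift K (tensor K V W) (\<lambda>v w.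
     tensor_lift K (tensor K V W) (\<lambda>v' w'. tens K V W (v \<otimes>\<^bsub>V\<^esub> v') (w \<otimes>\<^bsub>W\<^esub> w')) t) s)
     \<in> linear_maps K (tensor K V W) (tensor K V W)"
    by (rule tensor_lift_linear[OF V W VW mult_lift_bilinear[OF VW tb t]])
  show "(\<lambda>s. tensor_lift K (tensor K V W) (\<lambda>v w.
     tensor_lift K (tensor K V W) (\<lambda>v' w'. tens K V W (v \<otimes>\<^bsub>V\<^esub> v') (w \<otimes>\<^bsub>W\<^esub> w')) s) t)
     \<in> linear_maps K (tensor K V W) (tensor K V W)"
    by (rule linear_tensor_lift_param[OF V W VW VW t mult_lift_bilinear[OF VW tb]
          tensor_lift_linear[OF V W VW mult_bilinear_left[OF tb]]])
qed

lemma tensor_lift_mult: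
  assumes P: "module K P" and b: "b \<in> bilinear_maps K V W P"
    and s: "s \<in> carrier (tensor K V W)" and t: "t \<in> carrier (tensor K V W)"
  shows "tensor_lift K P b (s \<otimes>\<^bsub>tensor K V W\<^esub> t) =
    tensor_lift K P (\<lambda>v w. tensor_lift K P (\<lambda>v' w'. b (v \<otimes>\<^bsub>V\<^esub> v') (w \<otimes>\<^bsub>W\<^esub> w')) t) s"
proof -
  let ?T = "tensor K V W"
  note tb = tens_bilinear[OF V W]
  note \<phi> = tensor_lift_linear[OF V W P b]
  have "tensor_lift K P b (s \<otimes>\<^bsub>?T\<^esub> t) = tensor_lift K P (\<lambda>v w. tensor_lift K P b
     (tensor_lift K ?T (\<lambda>v' w'. tens K V W (v \<otimes>\<^bsub>V\<^esub> v') (w \<otimes>\<^bsub>W\<^esub> w')) t)) s"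
    unfolding tensor_mult_eq
    by (rule linear_tensor_lift[OF V W VW P \<phi> mult_lift_bilinear[OF VW tb t] s])
  also have "\<dots> =
    tensor_lift K P (\<lambda>v w. tensor_lift K P (\<lambda>v' w'. b (v \<otimes>\<^bsub>V\<^esub> v') (w \<otimes>\<^bsub>W\<^esub> w')) t) s"
  proof (rule tensor_lift_cong[OF V W s])
    fix v w assume v: "v \<in> carrier V" and w: "w \<in> carrier W"
    have "tensor_lift K P b
        (tensor_lift K ?T (\<lambda>v' w'. tens K V W (v \<otimes>\<^bsub>V\<^esub> v') (w \<otimes>\<^bsub>W\<^esub> w')) t) =
      tensor_lift K P (\<lambda>v' w'. tensor_lift K P b (tens K V W (v \<otimes>\<^bsub>V\<^esub> v') (w \<otimes>\<^bsub>W\<^esub> w'))) t"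
      by (rule linear_tensor_lift[OF V W VW P \<phi> mult_bilinear_left[OF tb v w] t])
    also have "\<dots> = tensor_lift K P (\<lambda>v' w'. b (v \<otimes>\<^bsub>V\<^esub> v') (w \<otimes>\<^bsub>W\<^esub> w')) t"
      by (rule tensor_lift_cong[OF V W t])
         (simp add: tensor_lift_tens[OF V W P b] bilinear_closed[OF mV] bilinear_closed[OF mW] v w)
    finally show "tensor_lift K P b
        (tensor_lift K ?T (\<lambda>v' w'. tens K V W (v \<otimes>\<^bsub>V\<^esub> v') (w \<otimes>\<^bsub>W\<^esub> w')) t) =
      tensor_lift K P (\<lambda>v' w'. b (v \<otimes>\<^bsub>V\<^esub> v') (w \<otimes>\<^bsub>W\<^esub> w')) t" .
  qed
  finally show ?thesis .
qed

lemma tensor_lift_mult_swapped: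
  assumes P: "module K P" and b: "b \<in> bilinear_maps K V W P"
    and s: "s \<in> carrier (tensor K V W)" and t: "t \<in> carrier (tensor K V W)"
  shows "tensor_lift K P b (s \<otimes>\<^bsub>tensor K V W\<^esub> t) =
    tensor_lift K P (\<lambda>v' w'. tensor_lift K P (\<lambda>v w. b (v \<otimes>\<^bsub>V\<^esub> v') (w \<otimes>\<^bsub>W\<^esub> w')) s) t"
  unfolding tensor_lift_mult[OF P b s t]
  by (rule tensor_lift_swap[OF V W V W P s t mult_bilinear_left[OF b] mult_bilinear_right[OF b]])

end

lemma (in assoc_algebra) algebra_mult_bilinear:
  "(\<lambda>x y. x \<otimes>\<^bsub>A\<^esub> y) \<in> bilinear_maps K A A A"
  by (intro bilinearI linear_mapsI)
     (auto simp: mult_closed mult_add_left mult_add_right mult_smult_left mult_smult_right)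


section \<open>Sweedler calculus for bicomodule algebras\<close>

text \<open>The data of an \<open>(L,R)\<close>-smash product: a Hopf algebra, a partial bimodule algebra and a partial
  bicomodule algebra over it.\<close>

locale lr_smash_data =
  fixes K :: "('k, 'm) ring_scheme"
    and H :: "('k, 'h) module" and \<Delta> :: "'h \<Rightarrow> ('h \<times> 'h \<Rightarrow> 'k) set"
    and \<epsilon> :: "'h \<Rightarrow> 'k" and S :: "'h \<Rightarrow> 'h"
    and A :: "('k, 'a) module" and L :: "('h \<times> 'a \<Rightarrow> 'k) set \<Rightarrow> 'a"
    and R :: "('a \<times> 'h \<Rightarrow> 'k) set \<Rightarrow> 'a"
    and B :: "('k, 'b) module" and lam :: "'b \<Rightarrow> ('h \<times> 'b \<Rightarrow> 'k) set"
    and rho :: "'b \<Rightarrow> ('b \<times> 'h \<Rightarrow> 'k) set"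
  assumes hopf: "hopf_algebra K H \<Delta> \<epsilon> S"
    and bimodule: "partial_bimodule_algebra K H \<Delta> L A R"
    and bicomodule: "partial_bicomodule_algebra K H \<Delta> \<epsilon> lam B rho"
begin

text \<open>In the interpretations \<open>H\<close> and \<open>B\<close>, the further qualifier \<open>A\<close> refers to the multiplicative monoid
  of the algebra; without it, facts such as \<open>one_closed\<close> concern the ground field.\<close>

interpretation H: hopf_algebra K H \<Delta> \<epsilon> S by (rule hopf)
interpretation A: partial_bimodule_algebra K H \<Delta> L A R
  "\<lambda>h a. L (tens K H A h a)" "\<lambda>a h. R (tens K A H a h)" by (rule bimodule)
interpretation B: partial_bicomodule_algebra K H \<Delta> \<epsilon> lam B rho by (rule bicomodule)

abbreviation lact :: "'h \<Rightarrow> 'a \<Rightarrow> 'a" (infixr \<open>\<rightharpoonup>\<close> 75) where "h \<rightharpoonup> a \<equiv> L (tens K H A h a)"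
abbreviation ract :: "'a \<Rightarrow> 'h \<Rightarrow> 'a" (infixl \<open>\<leftharpoonup>\<close> 75) where "a \<leftharpoonup> h \<equiv> R (tens K A H a h)"

lemma mods: "module K H" "module K A" "module K B"
  by (rule H.module_axioms A.module_axioms B.module_axioms)+

lemmas tensor_mods = mods tensor_is_module[OF mods(1) mods(1)] tensor_is_module[OF mods(1) mods(3)]
  tensor_is_module[OF mods(3) mods(1)] tensor_is_module[OF mods(2) mods(3)]

lemma lact_bilinear: "(\<lambda>h a. h \<rightharpoonup> a) \<in> bilinear_maps K H A A"
  by (intro bilinearI linear_compose[OF A.left_linear] bilinear_left[OF tens_bilinear]
      bilinear_right[OF tens_bilinear] mods)

lemma ract_bilinear: "(\<lambda>a h. a \<leftharpoonup> h) \<in> bilinear_maps K A H A"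
  by (intro bilinearI linear_compose[OF A.right_linear] bilinear_left[OF tens_bilinear]
      bilinear_right[OF tens_bilinear] mods)

lemmas comodule_closed = linear_closed[OF H.comult_linear] linear_closed[OF B.lam_linear]
  linear_closed[OF B.rho_linear]

lemmas closed = bilinear_closed[OF lact_bilinear] bilinear_closed[OF ract_bilinear] H.mult_closed
  A.mult_closed B.mult_closed tens_closed[OF mods(2) mods(3)] comodule_closed
  H.A.one_closed B.A.one_closed

lemmas lin_intros = linear_ident
  linear_bilinear_left[OF lact_bilinear] linear_bilinear_right[OF lact_bilinear]
  linear_bilinear_left[OF ract_bilinear] linear_bilinear_right[OF ract_bilinear]
  linear_bilinear_left[OF H.algebra_mult_bilinear] linear_bilinear_right[OF H.algebra_mult_bilinear]
  linear_bilinear_left[OF A.algebra_mult_bilinear] linear_bilinear_right[OF A.algebra_mult_bilinear]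
  linear_bilinear_left[OF B.algebra_mult_bilinear] linear_bilinear_right[OF B.algebra_mult_bilinear]
  linear_bilinear_left[OF tens_bilinear[OF mods(2) mods(3)]]
  linear_bilinear_right[OF tens_bilinear[OF mods(2) mods(3)]]
  linear_compose[OF H.comult_linear] linear_compose[OF B.lam_linear] linear_compose[OF B.rho_linear]

text \<open>Sums over \<open>\<Delta>\<close>, \<open>\<lambda>\<close> and \<open>\<rho>\<close> depend linearly on the element that is expanded and on
  parameters of the summand.\<close>

lemma sum_linear_arg:
  assumes "module K P"
  shows "\<lbrakk>(\<lambda>h k. b h k) \<in> bilinear_maps K H H P; f \<in> linear_maps K X H\<rbrakk> \<Longrightarrow>
      (\<lambda>x. tensor_lift K P (\<lambda>h k. b h k) (\<Delta> (f x))) \<in> linear_maps K X P"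
    and "\<lbrakk>(\<lambda>h u. c h u) \<in> bilinear_maps K H B P; g \<in> linear_maps K X B\<rbrakk> \<Longrightarrow>
      (\<lambda>x. tensor_lift K P (\<lambda>h u. c h u) (lam (g x))) \<in> linear_maps K X P"
    and "\<lbrakk>(\<lambda>u h. d u h) \<in> bilinear_maps K B H P; g \<in> linear_maps K X B\<rbrakk> \<Longrightarrow>
      (\<lambda>x. tensor_lift K P (\<lambda>u h. d u h) (rho (g x))) \<in> linear_maps K X P"
proof -
  show "(\<lambda>x. tensor_lift K P (\<lambda>h k. b h k) (\<Delta> (f x))) \<in> linear_maps K X P"
    if "(\<lambda>h k. b h k) \<in> bilinear_maps K H H P" "f \<in> linear_maps K X H"
    by (rule linear_tensor_lift_arg[OF mods(1) mods(1) assms that(1)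
          linear_compose[OF H.comult_linear that(2)]])
  show "(\<lambda>x. tensor_lift K P (\<lambda>h u. c h u) (lam (g x))) \<in> linear_maps K X P"
    if "(\<lambda>h u. c h u) \<in> bilinear_maps K H B P" "g \<in> linear_maps K X B"
    by (rule linear_tensor_lift_arg[OF mods(1) mods(3) assms that(1)
          linear_compose[OF B.lam_linear that(2)]])
  show "(\<lambda>x. tensor_lift K P (\<lambda>u h. d u h) (rho (g x))) \<in> linear_maps K X P"
    if "(\<lambda>u h. d u h) \<in> bilinear_maps K B H P" "g \<in> linear_maps K X B"
    by (rule linear_tensor_lift_arg[OF mods(3) mods(1) assms that(1)
          linear_compose[OF B.rho_linear that(2)]])
qed

lemmas sum_linear_param =
  linear_tensor_lift_param[OF mods(1) mods(1) _ _ linear_closed[OF H.comult_linear]]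
  linear_tensor_lift_param[OF mods(1) mods(3) _ _ linear_closed[OF B.lam_linear]]
  linear_tensor_lift_param[OF mods(3) mods(1) _ _ linear_closed[OF B.rho_linear]]

lemma sum_cong:
  "\<lbrakk>h \<in> carrier H; \<And>h\<^sub>1 h\<^sub>2. \<lbrakk>h\<^sub>1 \<in> carrier H; h\<^sub>2 \<in> carrier H\<rbrakk> \<Longrightarrow> b h\<^sub>1 h\<^sub>2 = b' h\<^sub>1 h\<^sub>2\<rbrakk> \<Longrightarrow>
    tensor_lift K P (\<lambda>h k. b h k) (\<Delta> h) = tensor_lift K P (\<lambda>h k. b' h k) (\<Delta> h)"
  "\<lbrakk>u \<in> carrier B; \<And>h v. \<lbrakk>h \<in> carrier H; v \<in> carrier B\<rbrakk> \<Longrightarrow> c h v = c' h v\<rbrakk> \<Longrightarrow>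
    tensor_lift K P (\<lambda>h k. c h k) (lam u) = tensor_lift K P (\<lambda>h k. c' h k) (lam u)"
  "\<lbrakk>u \<in> carrier B; \<And>v h. \<lbrakk>v \<in> carrier B; h \<in> carrier H\<rbrakk> \<Longrightarrow> d v h = d' v h\<rbrakk> \<Longrightarrow>
    tensor_lift K P (\<lambda>h k. d h k) (rho u) = tensor_lift K P (\<lambda>h k. d' h k) (rho u)"
  by (rule tensor_lift_cong; auto intro: mods comodule_closed)+

context
  fixes P :: "('k, 'p) module"
  assumes P: "module K P"
begin

lemma lam_sum_mult:
  assumes b: "b \<in> bilinear_maps K H B P" and u: "u \<in> carrier B" and v: "v \<in> carrier B"
  shows "tensor_lift K P b (lam (u \<otimes>\<^bsub>B\<^esub> v)) =
    tensor_lift K P (\<lambda>k x. tensor_lift K P (\<lambda>k' x'. b (k \<otimes>\<^bsub>H\<^esub> k') (x \<otimes>\<^bsub>B\<^esub> x')) (lam v)) (lam u)"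
  unfolding B.lam_mult[OF u v]
  by (rule tensor_lift_mult[OF _ _ H.algebra_mult_bilinear B.algebra_mult_bilinear P b])
     (intro mods closed u v)+

text \<open>The identity \<open>(I \<otimes> \<rho>)\<lambda> = (\<lambda> \<otimes> I)\<rho>\<close> in terms of sums.\<close>

lemma lam_rho_sum:
  assumes G: "G \<in> trilinear_maps K H B H P" and u: "u \<in> carrier B"
  shows "tensor_lift K P (\<lambda>h u'. tensor_lift K P (\<lambda>x g. G h x g) (rho u')) (lam u) =
    tensor_lift K P (\<lambda>u' g. tensor_lift K P (\<lambda>h x. G h x g) (lam u')) (rho u)"
proof -
  let ?\<Phi> = "\<lambda>h t. tensor_lift K P (\<lambda>x g. G h x g) t"
  have "tensor_lift K P (\<lambda>h u'. ?\<Phi> h (rho u')) (lam u) =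
      tensor_lift K P ?\<Phi> (tensor_map K H (tensor K B H) (\<lambda>h. h) rho (lam u))"
    by (rule tensor_lift_map[where X = H and Y = B, symmetric])
       (intro tensor_mods P linear_ident B.rho_linear closed u
         trilinear_lift_right_bilinear[OF _ _ _ _ G])+
  also have "\<dots> = tensor_lift K P ?\<Phi>
      (tensor_assoc K H B H (tensor_map K (tensor K H B) H lam (\<lambda>h. h) (rho u)))"
    using B.lam_rho[OF u] by (simp add: id_def)
  also have "\<dots> = tensor_lift K P (\<lambda>t g. tensor_lift K P (\<lambda>h x. G h x g) t)
      (tensor_map K (tensor K H B) H lam (\<lambda>h. h) (rho u))"
    by (rule tensor_lift_assoc[OF _ _ _ _ G])
       (intro tensor_mods P tensor_map_closed[where X = B and Y = H] linear_ident B.lam_linear closed u)+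
  also have "\<dots> = tensor_lift K P (\<lambda>u' g. tensor_lift K P (\<lambda>h x. G h x g) (lam u')) (rho u)"
    by (rule tensor_lift_map[where X = B and Y = H])
       (intro tensor_mods P linear_ident B.lam_linear closed u
         trilinear_lift_left_bilinear[OF _ _ _ _ G])+
  finally show ?thesis .
qed

text \<open>The partial coassociativity of \<open>\<lambda>\<close> in terms of sums.\<close>

lemma lam_sum_partial:
  assumes G: "G \<in> trilinear_maps K H H B P" and u: "u \<in> carrier B"
  shows "tensor_lift K P (\<lambda>h u'. tensor_lift K P (\<lambda>k x. G h k x) (lam u')) (lam u) =
    tensor_lift K P (\<lambda>h u'. tensor_lift K P (\<lambda>h\<^sub>1 h\<^sub>2.
      tensor_lift K P (\<lambda>k x. G h\<^sub>1 (h\<^sub>2 \<otimes>\<^bsub>H\<^esub> k) (u' \<otimes>\<^bsub>B\<^esub> x)) (lam \<one>\<^bsub>B\<^esub>)) (\<Delta> h)) (lam u)"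
proof -
  let ?\<Phi> = "\<lambda>h t. tensor_lift K P (\<lambda>k x. G h k x) t"
  let ?HB = "tensor K H B"
  let ?X = "tensor_assoc K H H B (tensor_map K (tensor K H H) B \<Delta> (\<lambda>x. x) (lam u))"
  let ?G = "\<lambda>h k x. tensor_lift K P (\<lambda>k' x'. G h (k \<otimes>\<^bsub>H\<^esub> k') (x \<otimes>\<^bsub>B\<^esub> x')) (lam \<one>\<^bsub>B\<^esub>)"
  note \<Phi> = trilinear_lift_right_bilinear[OF mods(1) mods(1) mods(3) P G]
  have G': "?G \<in> trilinear_maps K H H B P"
    by (intro trilinearI sum_linear_param bilinearI lin_intros linear_trilinear[OF G] closed P mods)
  have HB_mult: "(\<lambda>x y. x \<otimes>\<^bsub>?HB\<^esub> y) \<in> bilinear_maps K ?HB ?HB ?HB"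
    by (intro tensor_mult_bilinear mods H.algebra_mult_bilinear B.algebra_mult_bilinear)
  have lam1: "lam \<one>\<^bsub>B\<^esub> \<in> carrier ?HB" by (intro closed)
  have one_lam1: "tens K H ?HB \<one>\<^bsub>H\<^esub> (lam \<one>\<^bsub>B\<^esub>) \<in> carrier (tensor K H ?HB)"
    by (intro tens_closed tensor_mods closed)
  have X: "?X \<in> carrier (tensor K H ?HB)"
    by (intro tensor_assoc_closed tensor_map_closed[where X = H and Y = B] tensor_mods H.comult_linear linear_ident
        closed u)
  have "tensor_lift K P (\<lambda>h u'. ?\<Phi> h (lam u')) (lam u) =
      tensor_lift K P ?\<Phi> (tensor_map K H ?HB (\<lambda>h. h) lam (lam u))"
    by (rule tensor_lift_map[where X = H and Y = B, symmetric])
       (intro tensor_mods P linear_ident B.lam_linear closed u \<Phi>)+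
  also have "\<dots> = tensor_lift K P ?\<Phi>
      (?X \<otimes>\<^bsub>tensor K H ?HB\<^esub> tens K H ?HB \<one>\<^bsub>H\<^esub> (lam \<one>\<^bsub>B\<^esub>))"
    using B.lam_partial[OF u] by (simp add: id_def)
  also have "\<dots> = tensor_lift K P (\<lambda>h t. tensor_lift K P (\<lambda>h' t'. ?\<Phi> (h \<otimes>\<^bsub>H\<^esub> h') (t \<otimes>\<^bsub>?HB\<^esub> t'))
      (tens K H ?HB \<one>\<^bsub>H\<^esub> (lam \<one>\<^bsub>B\<^esub>))) ?X"
    by (rule tensor_lift_mult[OF _ _ H.algebra_mult_bilinear HB_mult P \<Phi> X one_lam1])
       (intro tensor_mods)+
  also have "\<dots> = tensor_lift K P (\<lambda>h t. tensor_lift K P (\<lambda>k x. ?G h k x) t) ?X"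
  proof (rule tensor_lift_cong[OF mods(1) tensor_mods(5) X])
    fix h t assume h: "h \<in> carrier H" and t: "t \<in> carrier ?HB"
    have "(\<lambda>h' t'. ?\<Phi> (h \<otimes>\<^bsub>H\<^esub> h') (t \<otimes>\<^bsub>?HB\<^esub> t')) \<in> bilinear_maps K H ?HB P"
      by (intro bilinearI linear_bilinear_left[OF \<Phi>] linear_bilinear_right[OF \<Phi>]
          linear_bilinear_right[OF HB_mult] bilinear_closed[OF HB_mult] lin_intros closed h t)
    from tensor_lift_tens[OF mods(1) tensor_mods(5) P this H.A.one_closed lam1]
    have "tensor_lift K P (\<lambda>h' t'. ?\<Phi> (h \<otimes>\<^bsub>H\<^esub> h') (t \<otimes>\<^bsub>?HB\<^esub> t'))
        (tens K H ?HB \<one>\<^bsub>H\<^esub> (lam \<one>\<^bsub>B\<^esub>)) = ?\<Phi> h (t \<otimes>\<^bsub>?HB\<^esub> lam \<one>\<^bsub>B\<^esub>)"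
      using h by simp
    also have "\<dots> = tensor_lift K P (\<lambda>k x. ?G h k x) t"
      by (rule tensor_lift_mult[OF _ _ H.algebra_mult_bilinear B.algebra_mult_bilinear P
            trilinear_bilinear(3)[OF G h] t lam1]) (intro mods)+
    finally show "tensor_lift K P (\<lambda>h' t'. ?\<Phi> (h \<otimes>\<^bsub>H\<^esub> h') (t \<otimes>\<^bsub>?HB\<^esub> t'))
        (tens K H ?HB \<one>\<^bsub>H\<^esub> (lam \<one>\<^bsub>B\<^esub>)) = tensor_lift K P (\<lambda>k x. ?G h k x) t" .
  qed
  also have "\<dots> = tensor_lift K P (\<lambda>t x. tensor_lift K P (\<lambda>h k. ?G h k x) t)
      (tensor_map K (tensor K H H) B \<Delta> (\<lambda>x. x) (lam u))"
    by (rule tensor_lift_assoc[OF _ _ _ _ G'])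
       (intro tensor_mods P tensor_map_closed[where X = H and Y = B] linear_ident H.comult_linear closed u)+
  also have "\<dots> = tensor_lift K P (\<lambda>h u'. tensor_lift K P (\<lambda>h\<^sub>1 h\<^sub>2. ?G h\<^sub>1 h\<^sub>2 u') (\<Delta> h)) (lam u)"
    by (rule tensor_lift_map[where X = H and Y = B])
       (intro tensor_mods P linear_ident H.comult_linear closed u
         trilinear_lift_left_bilinear[OF _ _ _ _ G'])+
  finally show ?thesis .
qed

text \<open>In this form the partial coassociativity of \<open>\<lambda>\<close> no longer mentions the idempotent
  \<open>\<lambda>(1)\<close>: it is absorbed by \<open>\<lambda>(v)\<close>, because \<open>\<lambda>(1)\<lambda>(v) = \<lambda>(1 v)\<close>. This is the only form in which
  the axiom enters the proof of associativity.\<close>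

lemma lam_sum_twist:
  assumes G: "G \<in> trilinear_maps K H H B P" and u: "u \<in> carrier B" and v: "v \<in> carrier B"
  shows "tensor_lift K P (\<lambda>h u'. tensor_lift K P (\<lambda>k x. G h k x) (lam (u' \<otimes>\<^bsub>B\<^esub> v))) (lam u) =
    tensor_lift K P (\<lambda>h u'. tensor_lift K P (\<lambda>h\<^sub>1 h\<^sub>2.
      tensor_lift K P (\<lambda>k x. G h\<^sub>1 (h\<^sub>2 \<otimes>\<^bsub>H\<^esub> k) (u' \<otimes>\<^bsub>B\<^esub> x)) (lam v)) (\<Delta> h)) (lam u)"
proof -
  let ?G = "\<lambda>h k x. tensor_lift K P (\<lambda>k' x'. G h (k \<otimes>\<^bsub>H\<^esub> k') (x \<otimes>\<^bsub>B\<^esub> x')) (lam v)"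
  have G': "?G \<in> trilinear_maps K H H B P"
    by (intro trilinearI sum_linear_param bilinearI lin_intros linear_trilinear[OF G] closed P mods v)
  have "tensor_lift K P (\<lambda>h u'. tensor_lift K P (\<lambda>k x. G h k x) (lam (u' \<otimes>\<^bsub>B\<^esub> v))) (lam u) =
      tensor_lift K P (\<lambda>h u'. tensor_lift K P (\<lambda>k x. ?G h k x) (lam u')) (lam u)"
    by (rule sum_cong(2)[OF u], rule lam_sum_mult[OF trilinear_bilinear(3)[OF G] _ v])
  also have "\<dots> = tensor_lift K P (\<lambda>h u'. tensor_lift K P (\<lambda>h\<^sub>1 h\<^sub>2.
      tensor_lift K P (\<lambda>k x. ?G h\<^sub>1 (h\<^sub>2 \<otimes>\<^bsub>H\<^esub> k) (u' \<otimes>\<^bsub>B\<^esub> x)) (lam \<one>\<^bsub>B\<^esub>)) (\<Delta> h)) (lam u)"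
    by (rule lam_sum_partial[OF G' u])
  also have "\<dots> = tensor_lift K P (\<lambda>h u'. tensor_lift K P (\<lambda>h\<^sub>1 h\<^sub>2.
      tensor_lift K P (\<lambda>k x. G h\<^sub>1 (h\<^sub>2 \<otimes>\<^bsub>H\<^esub> k) (u' \<otimes>\<^bsub>B\<^esub> x)) (lam v)) (\<Delta> h)) (lam u)"
  proof (intro sum_cong u)
    fix h u' h\<^sub>1 h\<^sub>2
    assume u': "u' \<in> carrier B" and h: "h \<in> carrier H" "h\<^sub>1 \<in> carrier H" "h\<^sub>2 \<in> carrier H"
    let ?b = "\<lambda>k x. G h\<^sub>1 (h\<^sub>2 \<otimes>\<^bsub>H\<^esub> k) (u' \<otimes>\<^bsub>B\<^esub> x)"
    have "?b \<in> bilinear_maps K H B P"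
      by (intro bilinearI lin_intros linear_trilinear[OF G] closed u' h)
    from lam_sum_mult[OF this B.A.one_closed v]
    have "tensor_lift K P ?b (lam v) = tensor_lift K P (\<lambda>k x. tensor_lift K P
        (\<lambda>k' x'. G h\<^sub>1 (h\<^sub>2 \<otimes>\<^bsub>H\<^esub> (k \<otimes>\<^bsub>H\<^esub> k')) (u' \<otimes>\<^bsub>B\<^esub> (x \<otimes>\<^bsub>B\<^esub> x'))) (lam v)) (lam \<one>\<^bsub>B\<^esub>)"
      using v by simp
    also have "\<dots> = tensor_lift K P (\<lambda>k x. ?G h\<^sub>1 (h\<^sub>2 \<otimes>\<^bsub>H\<^esub> k) (u' \<otimes>\<^bsub>B\<^esub> x)) (lam \<one>\<^bsub>B\<^esub>)"
      by (intro sum_cong v B.A.one_closed) (simp add: H.mult_assoc B.mult_assoc u' h)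
    finally show "tensor_lift K P (\<lambda>k x. ?G h\<^sub>1 (h\<^sub>2 \<otimes>\<^bsub>H\<^esub> k) (u' \<otimes>\<^bsub>B\<^esub> x)) (lam \<one>\<^bsub>B\<^esub>) =
        tensor_lift K P ?b (lam v)" ..
  qed
  finally show ?thesis .
qed

text \<open>The mirror images of the previous two lemmas. Here the idempotent \<open>\<rho>(1)\<close> stands on the left,
  so products of tensors are expanded with the sum over the right factor outermost.\<close>

lemma rho_sum_partial:
  assumes G: "G \<in> trilinear_maps K B H H P" and u: "u \<in> carrier B"
  shows "tensor_lift K P (\<lambda>u' g. tensor_lift K P (\<lambda>x k. G x k g) (rho u')) (rho u) =
    tensor_lift K P (\<lambda>u' g. tensor_lift K P (\<lambda>x k.
      tensor_lift K P (\<lambda>g\<^sub>1 g\<^sub>2. G (x \<otimes>\<^bsub>B\<^esub> u') (k \<otimes>\<^bsub>H\<^esub> g\<^sub>1) g\<^sub>2) (\<Delta> g)) (rho \<one>\<^bsub>B\<^esub>)) (rho u)"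
proof -
  let ?HH = "tensor K H H"
  let ?\<Phi> = "\<lambda>x t. tensor_lift K P (\<lambda>k g. G x k g) t"
  let ?s = "tensor_assoc K B H H (tens K (tensor K B H) H (rho \<one>\<^bsub>B\<^esub>) \<one>\<^bsub>H\<^esub>)"
  let ?t = "tensor_map K B ?HH (\<lambda>x. x) \<Delta> (rho u)"
  note \<Phi> = trilinear_lift_right_bilinear[OF mods(3) mods(1) mods(1) P G]
  have HH_mult: "(\<lambda>x y. x \<otimes>\<^bsub>?HH\<^esub> y) \<in> bilinear_maps K ?HH ?HH ?HH"
    by (intro tensor_mult_bilinear mods H.algebra_mult_bilinear)
  have r: "tens K (tensor K B H) H (rho \<one>\<^bsub>B\<^esub>) \<one>\<^bsub>H\<^esub> \<in> carrier (tensor K (tensor K B H) H)"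
    by (intro tens_closed tensor_mods closed)
  have s: "?s \<in> carrier (tensor K B ?HH)" by (intro tensor_assoc_closed tensor_mods r)
  have t: "?t \<in> carrier (tensor K B ?HH)"
    by (intro tensor_map_closed[where X = B and Y = H] tensor_mods H.comult_linear linear_ident closed u)
  note \<Phi>_intros = linear_bilinear_left[OF \<Phi>] linear_bilinear_right[OF \<Phi>]
    linear_bilinear_right[OF HH_mult] linear_bilinear_left[OF HH_mult] bilinear_closed[OF HH_mult]
  have \<Phi>_mult: "(\<lambda>x' t'. ?\<Phi> (x' \<otimes>\<^bsub>B\<^esub> x) (t' \<otimes>\<^bsub>?HH\<^esub> z)) \<in> bilinear_maps K B ?HH P"
    if "x \<in> carrier B" "z \<in> carrier ?HH" for x z
    by (intro bilinearI \<Phi>_intros lin_intros closed that)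
  have \<Psi>: "(\<lambda>x' t'. tensor_lift K P (\<lambda>x t. ?\<Phi> (x \<otimes>\<^bsub>B\<^esub> x') (t \<otimes>\<^bsub>?HH\<^esub> t')) ?s)
      \<in> bilinear_maps K B ?HH P"
    by (intro bilinearI linear_tensor_lift_param[OF mods(3) tensor_mods(4) P _ s] tensor_mods \<Phi>_mult
        \<Phi>_intros lin_intros closed)
  have "tensor_lift K P (\<lambda>u' g. tensor_lift K P (\<lambda>x k. G x k g) (rho u')) (rho u) =
      tensor_lift K P (\<lambda>t g. tensor_lift K P (\<lambda>x k. G x k g) t)
        (tensor_map K (tensor K B H) H rho (\<lambda>h. h) (rho u))"
    by (rule tensor_lift_map[where X = B and Y = H, symmetric])
       (intro tensor_mods P linear_ident B.rho_linear closed u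
         trilinear_lift_left_bilinear[OF _ _ _ _ G])+
  also have "\<dots> = tensor_lift K P ?\<Phi>
      (tensor_assoc K B H H (tensor_map K (tensor K B H) H rho (\<lambda>h. h) (rho u)))"
    by (rule tensor_lift_assoc[OF _ _ _ _ G, symmetric])
       (intro tensor_mods P tensor_map_closed[where X = B and Y = H] linear_ident B.rho_linear closed u)+
  also have "\<dots> = tensor_lift K P ?\<Phi> (?s \<otimes>\<^bsub>tensor K B ?HH\<^esub> ?t)"
    using B.rho_partial[OF u] by (simp add: id_def)
  also have "\<dots> = tensor_lift K P (\<lambda>x' t'. tensor_lift K P
      (\<lambda>x t. ?\<Phi> (x \<otimes>\<^bsub>B\<^esub> x') (t \<otimes>\<^bsub>?HH\<^esub> t')) ?s) ?t"
    by (rule tensor_lift_mult_swapped[OF _ _ B.algebra_mult_bilinear HH_mult P \<Phi> s t])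
       (intro tensor_mods)+
  also have "\<dots> = tensor_lift K P (\<lambda>u' g. tensor_lift K P
      (\<lambda>x t. ?\<Phi> (x \<otimes>\<^bsub>B\<^esub> u') (t \<otimes>\<^bsub>?HH\<^esub> \<Delta> g)) ?s) (rho u)"
    by (rule tensor_lift_map[where X = B and Y = H])
       (intro tensor_mods P linear_ident H.comult_linear closed u \<Psi>)+
  also have "\<dots> = tensor_lift K P (\<lambda>u' g. tensor_lift K P (\<lambda>x k.
      tensor_lift K P (\<lambda>g\<^sub>1 g\<^sub>2. G (x \<otimes>\<^bsub>B\<^esub> u') (k \<otimes>\<^bsub>H\<^esub> g\<^sub>1) g\<^sub>2) (\<Delta> g)) (rho \<one>\<^bsub>B\<^esub>)) (rho u)"
  proof (rule sum_cong(3)[OF u])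
    fix u' g assume u': "u' \<in> carrier B" and g: "g \<in> carrier H"
    let ?G = "\<lambda>x k h. tensor_lift K P
      (\<lambda>g\<^sub>1 g\<^sub>2. G (x \<otimes>\<^bsub>B\<^esub> u') (k \<otimes>\<^bsub>H\<^esub> g\<^sub>1) (h \<otimes>\<^bsub>H\<^esub> g\<^sub>2)) (\<Delta> g)"
    have G': "?G \<in> trilinear_maps K B H H P"
      by (intro trilinearI sum_linear_param bilinearI lin_intros linear_trilinear[OF G] closed P
          mods u' g)
    have "tensor_lift K P (\<lambda>x t. ?\<Phi> (x \<otimes>\<^bsub>B\<^esub> u') (t \<otimes>\<^bsub>?HH\<^esub> \<Delta> g)) ?s =
        tensor_lift K P (\<lambda>x t. tensor_lift K P (\<lambda>k h. ?G x k h) t) ?s"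
      by (rule tensor_lift_cong[OF mods(3) tensor_mods(4) s],
          rule tensor_lift_mult[OF _ _ H.algebra_mult_bilinear H.algebra_mult_bilinear P
            trilinear_bilinear(3)[OF G]]) (intro mods closed u' g | assumption)+
    also have "\<dots> = tensor_lift K P (\<lambda>t h. tensor_lift K P (\<lambda>x k. ?G x k h) t)
        (tens K (tensor K B H) H (rho \<one>\<^bsub>B\<^esub>) \<one>\<^bsub>H\<^esub>)"
      by (rule tensor_lift_assoc[OF _ _ _ _ G' r]) (intro mods P)+
    also have "\<dots> = tensor_lift K P (\<lambda>x k. ?G x k \<one>\<^bsub>H\<^esub>) (rho \<one>\<^bsub>B\<^esub>)"
      by (rule tensor_lift_tens[OF _ _ P trilinear_lift_left_bilinear[OF _ _ _ P G']])
         (intro tensor_mods closed)+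
    also have "\<dots> = tensor_lift K P (\<lambda>x k.
      tensor_lift K P (\<lambda>g\<^sub>1 g\<^sub>2. G (x \<otimes>\<^bsub>B\<^esub> u') (k \<otimes>\<^bsub>H\<^esub> g\<^sub>1) g\<^sub>2) (\<Delta> g)) (rho \<one>\<^bsub>B\<^esub>)"
      by (intro sum_cong B.A.one_closed g) simp
    finally show "tensor_lift K P (\<lambda>x t. ?\<Phi> (x \<otimes>\<^bsub>B\<^esub> u') (t \<otimes>\<^bsub>?HH\<^esub> \<Delta> g)) ?s = \<dots>" .
  qed
  finally show ?thesis .
qed

lemma rho_sum_twist:
  assumes G: "G \<in> trilinear_maps K B H H P" and u: "u \<in> carrier B" and v: "v \<in> carrier B"
  shows "tensor_lift K P (\<lambda>u' g. tensor_lift K P (\<lambda>x k. G x k g) (rho (v \<otimes>\<^bsub>B\<^esub> u'))) (rho u) =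
    tensor_lift K P (\<lambda>u' g. tensor_lift K P (\<lambda>x k.
      tensor_lift K P (\<lambda>g\<^sub>1 g\<^sub>2. G (x \<otimes>\<^bsub>B\<^esub> u') (k \<otimes>\<^bsub>H\<^esub> g\<^sub>1) g\<^sub>2) (\<Delta> g)) (rho v)) (rho u)"
proof -
  let ?G = "\<lambda>x k g. tensor_lift K P (\<lambda>x' k'. G (x' \<otimes>\<^bsub>B\<^esub> x) (k' \<otimes>\<^bsub>H\<^esub> k) g) (rho v)"
  have G': "?G \<in> trilinear_maps K B H H P"
    by (intro trilinearI sum_linear_param bilinearI lin_intros linear_trilinear[OF G] closed P mods v)
  have "tensor_lift K P (\<lambda>u' g. tensor_lift K P (\<lambda>x k. G x k g) (rho (v \<otimes>\<^bsub>B\<^esub> u'))) (rho u) =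
      tensor_lift K P (\<lambda>u' g. tensor_lift K P (\<lambda>x k. ?G x k g) (rho u')) (rho u)"
  proof (rule sum_cong(3)[OF u])
    fix u' g assume u': "u' \<in> carrier B" and g: "g \<in> carrier H"
    show "tensor_lift K P (\<lambda>x k. G x k g) (rho (v \<otimes>\<^bsub>B\<^esub> u')) =
        tensor_lift K P (\<lambda>x k. ?G x k g) (rho u')"
      unfolding B.rho_mult[OF v u']
      by (rule tensor_lift_mult_swapped[OF _ _ B.algebra_mult_bilinear H.algebra_mult_bilinear P
            trilinear_bilinear(1)[OF G g]]) (intro mods closed u' v)+
  qed
  also have "\<dots> = tensor_lift K P (\<lambda>u' g. tensor_lift K P (\<lambda>x k.
      tensor_lift K P (\<lambda>g\<^sub>1 g\<^sub>2. ?G (x \<otimes>\<^bsub>B\<^esub> u') (k \<otimes>\<^bsub>H\<^esub> g\<^sub>1) g\<^sub>2) (\<Delta> g)) (rho \<one>\<^bsub>B\<^esub>)) (rho u)"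
    by (rule rho_sum_partial[OF G' u])
  also have "\<dots> = tensor_lift K P (\<lambda>u' g. tensor_lift K P (\<lambda>x k.
      tensor_lift K P (\<lambda>g\<^sub>1 g\<^sub>2. G (x \<otimes>\<^bsub>B\<^esub> u') (k \<otimes>\<^bsub>H\<^esub> g\<^sub>1) g\<^sub>2) (\<Delta> g)) (rho v)) (rho u)"
  proof (rule sum_cong(3)[OF u])
    fix u' g assume u': "u' \<in> carrier B" and g: "g \<in> carrier H"
    let ?b = "\<lambda>x k. tensor_lift K P (\<lambda>g\<^sub>1 g\<^sub>2. G (x \<otimes>\<^bsub>B\<^esub> u') (k \<otimes>\<^bsub>H\<^esub> g\<^sub>1) g\<^sub>2) (\<Delta> g)"
    have b: "?b \<in> bilinear_maps K B H P"
      by (intro sum_linear_param bilinearI lin_intros linear_trilinear[OF G] closed P mods u' g)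
    have "tensor_lift K P (\<lambda>x k. tensor_lift K P (\<lambda>g\<^sub>1 g\<^sub>2.
          ?G (x \<otimes>\<^bsub>B\<^esub> u') (k \<otimes>\<^bsub>H\<^esub> g\<^sub>1) g\<^sub>2) (\<Delta> g)) (rho \<one>\<^bsub>B\<^esub>) =
        tensor_lift K P (\<lambda>x k. tensor_lift K P (\<lambda>x' k'.
          ?b (x' \<otimes>\<^bsub>B\<^esub> x) (k' \<otimes>\<^bsub>H\<^esub> k)) (rho v)) (rho \<one>\<^bsub>B\<^esub>)"
    proof (rule sum_cong(3)[OF B.A.one_closed])
      fix x k assume x: "x \<in> carrier B" and k: "k \<in> carrier H"
      have "tensor_lift K P (\<lambda>g\<^sub>1 g\<^sub>2. ?G (x \<otimes>\<^bsub>B\<^esub> u') (k \<otimes>\<^bsub>H\<^esub> g\<^sub>1) g\<^sub>2) (\<Delta> g) =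
          tensor_lift K P (\<lambda>x' k'. tensor_lift K P (\<lambda>g\<^sub>1 g\<^sub>2.
            G (x' \<otimes>\<^bsub>B\<^esub> (x \<otimes>\<^bsub>B\<^esub> u')) (k' \<otimes>\<^bsub>H\<^esub> (k \<otimes>\<^bsub>H\<^esub> g\<^sub>1)) g\<^sub>2) (\<Delta> g)) (rho v)"
        by (rule tensor_lift_swap[OF mods(1) mods(1) mods(3) mods(1) P]) (intro mods P bilinearI lin_intros linear_trilinear[OF G] closed
            x k u' g v | assumption)+
      also have "\<dots> = tensor_lift K P (\<lambda>x' k'. ?b (x' \<otimes>\<^bsub>B\<^esub> x) (k' \<otimes>\<^bsub>H\<^esub> k)) (rho v)"
        by (intro sum_cong g v) (simp add: H.mult_assoc B.mult_assoc x k u')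
      finally show "tensor_lift K P (\<lambda>g\<^sub>1 g\<^sub>2. ?G (x \<otimes>\<^bsub>B\<^esub> u') (k \<otimes>\<^bsub>H\<^esub> g\<^sub>1) g\<^sub>2) (\<Delta> g) = \<dots>" .
    qed
    also have "\<dots> = tensor_lift K P ?b (rho v \<otimes>\<^bsub>tensor K B H\<^esub> rho \<one>\<^bsub>B\<^esub>)"
      by (rule tensor_lift_mult_swapped[OF _ _ B.algebra_mult_bilinear H.algebra_mult_bilinear P b,
            symmetric]) (intro mods closed v)+
    also have "\<dots> = tensor_lift K P ?b (rho v)"
      using v by (simp flip: B.rho_mult)
    finally show "tensor_lift K P (\<lambda>x k. tensor_lift K P (\<lambda>g\<^sub>1 g\<^sub>2.
          ?G (x \<otimes>\<^bsub>B\<^esub> u') (k \<otimes>\<^bsub>H\<^esub> g\<^sub>1) g\<^sub>2) (\<Delta> g)) (rho \<one>\<^bsub>B\<^esub>) = \<dots>" .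
  qed
  finally show ?thesis .
qed

end

section \<open>Associativity of the smash product\<close>

abbreviation M where "M \<equiv> tensor K A B"
abbreviation SP where "SP \<equiv> smash_product K H L A R lam B rho"

text \<open>Sweedler sums \<open>f h\<^sub>1 h\<^sub>2\<close> over \<open>\<Delta>(h)\<close>, \<open>f h u'\<close> over \<open>\<lambda>(u)\<close> and \<open>f u' h\<close> over \<open>\<rho>(u)\<close>, with values
  in \<open>A \<otimes> B\<close>.\<close>

abbreviation sumD where "sumD h f \<equiv> tensor_lift K M f (\<Delta> h)"
abbreviation sumL where "sumL u f \<equiv> tensor_lift K M f (lam u)"
abbreviation sumR where "sumR u f \<equiv> tensor_lift K M f (rho u)"

text \<open>The product of two pure tensors in the smash product.\<close>

definition smash_pure :: "'a \<Rightarrow> 'b \<Rightarrow> 'a \<Rightarrow> 'b \<Rightarrow> ('a \<times> 'b \<Rightarrow> 'k) set"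
  where "smash_pure a u b v =
    sumL u (\<lambda>h u'. sumR v (\<lambda>v' g. tens K A B ((a \<leftharpoonup> g) \<otimes>\<^bsub>A\<^esub> (h \<rightharpoonup> b)) (u' \<otimes>\<^bsub>B\<^esub> v')))"

lemma M: "module K M" by (rule tensor_mods)

lemmas M_intros = bilinearI trilinearI sum_linear_param sum_linear_arg lin_intros M mods
  tensor_lift_closed[OF mods(1) mods(1) M] tensor_lift_closed[OF mods(1) mods(3) M]
  tensor_lift_closed[OF mods(3) mods(1) M] closed

lemma smash_pure_bilinear:
  "\<lbrakk>a \<in> carrier A; u \<in> carrier B\<rbrakk> \<Longrightarrow> (\<lambda>b v. smash_pure a u b v) \<in> bilinear_maps K A B M"
  "\<lbrakk>b \<in> carrier A; v \<in> carrier B\<rbrakk> \<Longrightarrow> (\<lambda>a u. smash_pure a u b v) \<in> bilinear_maps K A B M"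
  unfolding smash_pure_def by (intro M_intros; assumption)+

lemma smash_mult_eq:
  "s \<otimes>\<^bsub>SP\<^esub> t = tensor_lift K M (\<lambda>a u. tensor_lift K M (\<lambda>b v. smash_pure a u b v) t) s"
  by (simp add: smash_product_def Let_def smash_pure_def tensor_lift_tensor)

lemma smash_mult_bilinear: "(\<lambda>s t. s \<otimes>\<^bsub>SP\<^esub> t) \<in> bilinear_maps K M M M"
proof (intro bilinearI)
  note AB = mods(2,3)
  fix t assume t: "t \<in> carrier M"
  have "(\<lambda>a u. tensor_lift K M (\<lambda>b v. smash_pure a u b v) t) \<in> bilinear_maps K A B M"
    by (intro bilinearI linear_tensor_lift_param[OF AB M _ t] AB smash_pure_bilinear
        bilinear_left[OF smash_pure_bilinear(2)] bilinear_right[OF smash_pure_bilinear(2)])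
  then show "(\<lambda>s. s \<otimes>\<^bsub>SP\<^esub> t) \<in> linear_maps K M M"
    unfolding smash_mult_eq by (rule tensor_lift_linear[OF AB M])
next
  note AB = mods(2,3)
  fix s assume s: "s \<in> carrier M"
  have "(\<lambda>a u. tensor_lift K M (\<lambda>b v. smash_pure a u b v) t) \<in> bilinear_maps K A B M"
    if t: "t \<in> carrier M" for t
    by (intro bilinearI linear_tensor_lift_param[OF AB M _ t] AB smash_pure_bilinear
        bilinear_left[OF smash_pure_bilinear(2)] bilinear_right[OF smash_pure_bilinear(2)])
  then show "(\<lambda>t. s \<otimes>\<^bsub>SP\<^esub> t) \<in> linear_maps K M M"
    unfolding smash_mult_eq
    by (intro linear_tensor_lift_param[OF AB M M s] tensor_lift_linear[OF AB M smash_pure_bilinear(1)])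
qed

lemma smash_mult_tens:
  assumes "a \<in> carrier A" "u \<in> carrier B" "b \<in> carrier A" "v \<in> carrier B"
  shows "tens K A B a u \<otimes>\<^bsub>SP\<^esub> tens K A B b v = smash_pure a u b v"
proof -
  note AB = mods(2,3)
  have t: "tens K A B b v \<in> carrier M" using assms by (intro closed)
  have "(\<lambda>a u. tensor_lift K M (\<lambda>b v. smash_pure a u b v) (tens K A B b v)) \<in> bilinear_maps K A B M"
    by (intro bilinearI linear_tensor_lift_param[OF AB M _ t] AB smash_pure_bilinear
        bilinear_left[OF smash_pure_bilinear(2)] bilinear_right[OF smash_pure_bilinear(2)])
  then show ?thesis
    unfolding smash_mult_eq
    by (simp add: tensor_lift_tens[OF AB M] assms smash_pure_bilinear(1))
qed

text \<open>Both iterated products of three pure tensors are brought to the common form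
  \<open>sumR v (\<lambda>v' g. sumL v' (\<lambda>k x. \<Omega> g k x))\<close>, in which the inner sums over \<open>\<lambda>(u)\<close> and \<open>\<rho>(w)\<close>, and
  over the comultiplications of their components in \<open>H\<close>, make up \<open>\<Omega>\<close>.\<close>

lemma smash_mult_assoc_tens:
  assumes a: "a \<in> carrier A" and b: "b \<in> carrier A" and c: "c \<in> carrier A"
    and u: "u \<in> carrier B" and v: "v \<in> carrier B" and w: "w \<in> carrier B"
  shows "(tens K A B a u \<otimes>\<^bsub>SP\<^esub> tens K A B b v) \<otimes>\<^bsub>SP\<^esub> tens K A B c w =
    tens K A B a u \<otimes>\<^bsub>SP\<^esub> (tens K A B b v \<otimes>\<^bsub>SP\<^esub> tens K A B c w)"
proof -
  note elems = a b c u v w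
  note swapDD = tensor_lift_swap[OF mods(1) mods(1) mods(1) mods(1) M]
    and swapDL = tensor_lift_swap[OF mods(1) mods(1) mods(1) mods(3) M]
    and swapLL = tensor_lift_swap[OF mods(1) mods(3) mods(1) mods(3) M]
    and swapLR = tensor_lift_swap[OF mods(1) mods(3) mods(3) mods(1) M]
    and swapRL = tensor_lift_swap[OF mods(3) mods(1) mods(1) mods(3) M]
    and swapRD = tensor_lift_swap[OF mods(3) mods(1) mods(1) mods(1) M]
    and swapRR = tensor_lift_swap[OF mods(3) mods(1) mods(3) mods(1) M]
  let ?\<Theta> = "\<lambda>g g' h k y.
    tens K A B ((a \<leftharpoonup> g) \<otimes>\<^bsub>A\<^esub> ((h \<rightharpoonup> (b \<leftharpoonup> g')) \<otimes>\<^bsub>A\<^esub> (k \<rightharpoonup> c))) y"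
  let ?\<Phi> = "\<lambda>g h k x. sumR w (\<lambda>w' g'. sumD g' (\<lambda>g\<^sub>1 g\<^sub>2.
    ?\<Theta> (g \<otimes>\<^bsub>H\<^esub> g\<^sub>1) g\<^sub>2 h k (x \<otimes>\<^bsub>B\<^esub> w')))"
  let ?\<Psi> = "\<lambda>x g g' k. sumL u (\<lambda>h u'. sumD h (\<lambda>h\<^sub>1 h\<^sub>2. ?\<Theta> g g' h\<^sub>1 (h\<^sub>2 \<otimes>\<^bsub>H\<^esub> k) (u' \<otimes>\<^bsub>B\<^esub> x)))"
  let ?\<Omega> = "\<lambda>g k x. sumL u (\<lambda>h u'. sumD h (\<lambda>h\<^sub>1 h\<^sub>2. ?\<Phi> g h\<^sub>1 (h\<^sub>2 \<otimes>\<^bsub>H\<^esub> k) (u' \<otimes>\<^bsub>B\<^esub> x)))"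
  have act_commute: "(h \<rightharpoonup> b) \<leftharpoonup> g = h \<rightharpoonup> (b \<leftharpoonup> g)" if "h \<in> carrier H" "g \<in> carrier H" for h g
    using A.left_right[OF that b] ..

  have "smash_pure a u b v \<otimes>\<^bsub>SP\<^esub> tens K A B c w = sumL u (\<lambda>h u'.
      (sumR v (\<lambda>v' g. tens K A B ((a \<leftharpoonup> g) \<otimes>\<^bsub>A\<^esub> (h \<rightharpoonup> b)) (u' \<otimes>\<^bsub>B\<^esub> v')))
        \<otimes>\<^bsub>SP\<^esub> tens K A B c w)"
    unfolding smash_pure_def
    by (rule linear_tensor_lift[OF mods(1) mods(3) M M bilinear_left[OF smash_mult_bilinear]])
       (intro M_intros elems | assumption)+
  also have "\<dots> = sumL u (\<lambda>h u'. sumR v (\<lambda>v' g.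
      tens K A B ((a \<leftharpoonup> g) \<otimes>\<^bsub>A\<^esub> (h \<rightharpoonup> b)) (u' \<otimes>\<^bsub>B\<^esub> v') \<otimes>\<^bsub>SP\<^esub> tens K A B c w))"
    by (rule sum_cong(2)[OF u],
        rule linear_tensor_lift[OF mods(3) mods(1) M M bilinear_left[OF smash_mult_bilinear]])
       (intro M_intros elems | assumption)+
  also have "\<dots> = sumL u (\<lambda>h u'. sumR v (\<lambda>v' g. sumL (u' \<otimes>\<^bsub>B\<^esub> v') (\<lambda>k x. ?\<Phi> g h k x)))"
  proof (rule sum_cong(2)[OF u], rule sum_cong(3)[OF v])
    fix h u' v' g
    assume *: "h \<in> carrier H" "u' \<in> carrier B" "v' \<in> carrier B" "g \<in> carrier H"
    let ?d = "(a \<leftharpoonup> g) \<otimes>\<^bsub>A\<^esub> (h \<rightharpoonup> b)"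
    have "tens K A B ?d (u' \<otimes>\<^bsub>B\<^esub> v') \<otimes>\<^bsub>SP\<^esub> tens K A B c w = smash_pure ?d (u' \<otimes>\<^bsub>B\<^esub> v') c w"
      by (intro smash_mult_tens closed elems *)
    also have "\<dots> = sumL (u' \<otimes>\<^bsub>B\<^esub> v') (\<lambda>k x. ?\<Phi> g h k x)"
      unfolding smash_pure_def
    proof (intro sum_cong closed elems *)
      fix k x w' g'
      assume **: "k \<in> carrier H" "x \<in> carrier B" "w' \<in> carrier B" "g' \<in> carrier H"
      \<comment> \<open>The right partial action splits the first factor.\<close>
      have "?d \<leftharpoonup> g' = tensor_lift K A
          (\<lambda>g\<^sub>1 g\<^sub>2. (a \<leftharpoonup> (g \<otimes>\<^bsub>H\<^esub> g\<^sub>1)) \<otimes>\<^bsub>A\<^esub> ((h \<rightharpoonup> b) \<leftharpoonup> g\<^sub>2)) (\<Delta> g')"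
        by (intro A.right_partial closed elems * **)
      then have "tens K A B ((?d \<leftharpoonup> g') \<otimes>\<^bsub>A\<^esub> (k \<rightharpoonup> c)) (x \<otimes>\<^bsub>B\<^esub> w') =
          tens K A B (tensor_lift K A
          (\<lambda>g\<^sub>1 g\<^sub>2. (a \<leftharpoonup> (g \<otimes>\<^bsub>H\<^esub> g\<^sub>1)) \<otimes>\<^bsub>A\<^esub> ((h \<rightharpoonup> b) \<leftharpoonup> g\<^sub>2)) (\<Delta> g') \<otimes>\<^bsub>A\<^esub> (k \<rightharpoonup> c)) (x \<otimes>\<^bsub>B\<^esub> w')"
        by simp
      also have "\<dots> = sumD g' (\<lambda>g\<^sub>1 g\<^sub>2. tens K A B
          (((a \<leftharpoonup> (g \<otimes>\<^bsub>H\<^esub> g\<^sub>1)) \<otimes>\<^bsub>A\<^esub> ((h \<rightharpoonup> b) \<leftharpoonup> g\<^sub>2)) \<otimes>\<^bsub>A\<^esub> (k \<rightharpoonup> c)) (x \<otimes>\<^bsub>B\<^esub> w'))"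
        by (rule linear_tensor_lift[OF mods(1) mods(1) mods(2) M,
              where f = "\<lambda>d. tens K A B (d \<otimes>\<^bsub>A\<^esub> (k \<rightharpoonup> c)) (x \<otimes>\<^bsub>B\<^esub> w')"])
           (intro M_intros elems * ** | assumption)+
      also have "\<dots> = sumD g' (\<lambda>g\<^sub>1 g\<^sub>2. ?\<Theta> (g \<otimes>\<^bsub>H\<^esub> g\<^sub>1) g\<^sub>2 h k (x \<otimes>\<^bsub>B\<^esub> w'))"
        by (intro sum_cong **) (simp add: A.mult_assoc act_commute closed elems * **)
      finally show "tens K A B ((?d \<leftharpoonup> g') \<otimes>\<^bsub>A\<^esub> (k \<rightharpoonup> c)) (x \<otimes>\<^bsub>B\<^esub> w') = \<dots>" .
    qed
    finally show "tens K A B ?d (u' \<otimes>\<^bsub>B\<^esub> v') \<otimes>\<^bsub>SP\<^esub> tens K A B c w = \<dots>" .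
  qed
  \<comment> \<open>The sum over \<open>\<rho>(v)\<close> has to move outwards before the partial
    coassociativity of \<open>\<lambda>\<close> applies to the two sums over \<open>\<lambda>\<close>.\<close>
  also have "\<dots> = sumR v (\<lambda>v' g. sumL u (\<lambda>h u'. sumL (u' \<otimes>\<^bsub>B\<^esub> v') (\<lambda>k x. ?\<Phi> g h k x)))"
    by (rule swapLR) (intro M_intros elems | assumption)+
  also have "\<dots> = sumR v (\<lambda>v' g. sumL u (\<lambda>h u'. sumD h (\<lambda>h\<^sub>1 h\<^sub>2.
      sumL v' (\<lambda>k x. ?\<Phi> g h\<^sub>1 (h\<^sub>2 \<otimes>\<^bsub>H\<^esub> k) (u' \<otimes>\<^bsub>B\<^esub> x)))))"
    by (rule sum_cong(3)[OF v], rule lam_sum_twist[OF M _ u]) (intro M_intros elems | assumption)+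
  also have "\<dots> = sumR v (\<lambda>v' g. sumL u (\<lambda>h u'. sumL v' (\<lambda>k x.
      sumD h (\<lambda>h\<^sub>1 h\<^sub>2. ?\<Phi> g h\<^sub>1 (h\<^sub>2 \<otimes>\<^bsub>H\<^esub> k) (u' \<otimes>\<^bsub>B\<^esub> x)))))"
    by (rule sum_cong(3)[OF v], rule sum_cong(2)[OF u], rule swapDL)
       (intro M_intros elems | assumption)+
  also have "\<dots> = sumR v (\<lambda>v' g. sumL v' (\<lambda>k x. ?\<Omega> g k x))"
    by (rule sum_cong(3)[OF v], rule swapLL) (intro M_intros elems | assumption)+
  finally have left: "smash_pure a u b v \<otimes>\<^bsub>SP\<^esub> tens K A B c w = \<dots>" .

  have "tens K A B a u \<otimes>\<^bsub>SP\<^esub> smash_pure b v c w = sumL v (\<lambda>k v'. tens K A B a u \<otimes>\<^bsub>SP\<^esub>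
      sumR w (\<lambda>w' g'. tens K A B ((b \<leftharpoonup> g') \<otimes>\<^bsub>A\<^esub> (k \<rightharpoonup> c)) (v' \<otimes>\<^bsub>B\<^esub> w')))"
    unfolding smash_pure_def
    by (rule linear_tensor_lift[OF mods(1) mods(3) M M bilinear_right[OF smash_mult_bilinear]])
       (intro M_intros elems | assumption)+
  also have "\<dots> = sumL v (\<lambda>k v'. sumR w (\<lambda>w' g'. tens K A B a u \<otimes>\<^bsub>SP\<^esub>
      tens K A B ((b \<leftharpoonup> g') \<otimes>\<^bsub>A\<^esub> (k \<rightharpoonup> c)) (v' \<otimes>\<^bsub>B\<^esub> w')))"
    by (rule sum_cong(2)[OF v],
        rule linear_tensor_lift[OF mods(3) mods(1) M M bilinear_right[OF smash_mult_bilinear]])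
       (intro M_intros elems | assumption)+
  also have "\<dots> = sumL v (\<lambda>k v'. sumR w (\<lambda>w' g'. sumR (v' \<otimes>\<^bsub>B\<^esub> w') (\<lambda>x g. ?\<Psi> x g g' k)))"
  proof (rule sum_cong(2)[OF v], rule sum_cong(3)[OF w])
    fix k v' w' g'
    assume *: "k \<in> carrier H" "v' \<in> carrier B" "w' \<in> carrier B" "g' \<in> carrier H"
    let ?d = "(b \<leftharpoonup> g') \<otimes>\<^bsub>A\<^esub> (k \<rightharpoonup> c)"
    have "tens K A B a u \<otimes>\<^bsub>SP\<^esub> tens K A B ?d (v' \<otimes>\<^bsub>B\<^esub> w') = smash_pure a u ?d (v' \<otimes>\<^bsub>B\<^esub> w')"
      by (intro smash_mult_tens closed elems *)
    also have "\<dots> = sumR (v' \<otimes>\<^bsub>B\<^esub> w') (\<lambda>x g. sumL u (\<lambda>h u'.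
        tens K A B ((a \<leftharpoonup> g) \<otimes>\<^bsub>A\<^esub> (h \<rightharpoonup> ?d)) (u' \<otimes>\<^bsub>B\<^esub> x)))"
      unfolding smash_pure_def by (rule swapLR) (intro M_intros elems * | assumption)+
    also have "\<dots> = sumR (v' \<otimes>\<^bsub>B\<^esub> w') (\<lambda>x g. ?\<Psi> x g g' k)"
    proof (intro sum_cong closed elems *)
      fix x g h u'
      assume **: "x \<in> carrier B" "g \<in> carrier H" "h \<in> carrier H" "u' \<in> carrier B"
      \<comment> \<open>The left partial action splits the second factor.\<close>
      have "h \<rightharpoonup> ?d = tensor_lift K A
          (\<lambda>h\<^sub>1 h\<^sub>2. (h\<^sub>1 \<rightharpoonup> (b \<leftharpoonup> g')) \<otimes>\<^bsub>A\<^esub> ((h\<^sub>2 \<otimes>\<^bsub>H\<^esub> k) \<rightharpoonup> c)) (\<Delta> h)"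
        by (intro A.left_partial closed elems * **)
      then have "tens K A B ((a \<leftharpoonup> g) \<otimes>\<^bsub>A\<^esub> (h \<rightharpoonup> ?d)) (u' \<otimes>\<^bsub>B\<^esub> x) =
          tens K A B ((a \<leftharpoonup> g) \<otimes>\<^bsub>A\<^esub> tensor_lift K A
          (\<lambda>h\<^sub>1 h\<^sub>2. (h\<^sub>1 \<rightharpoonup> (b \<leftharpoonup> g')) \<otimes>\<^bsub>A\<^esub> ((h\<^sub>2 \<otimes>\<^bsub>H\<^esub> k) \<rightharpoonup> c)) (\<Delta> h)) (u' \<otimes>\<^bsub>B\<^esub> x)"
        by simp
      also have "\<dots> = sumD h (\<lambda>h\<^sub>1 h\<^sub>2. ?\<Theta> g g' h\<^sub>1 (h\<^sub>2 \<otimes>\<^bsub>H\<^esub> k) (u' \<otimes>\<^bsub>B\<^esub> x))"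
        by (rule linear_tensor_lift[OF mods(1) mods(1) mods(2) M,
              where f = "\<lambda>d. tens K A B ((a \<leftharpoonup> g) \<otimes>\<^bsub>A\<^esub> d) (u' \<otimes>\<^bsub>B\<^esub> x)"])
           (intro M_intros elems * ** | assumption)+
      finally show "tens K A B ((a \<leftharpoonup> g) \<otimes>\<^bsub>A\<^esub> (h \<rightharpoonup> ?d)) (u' \<otimes>\<^bsub>B\<^esub> x) = \<dots>" .
    qed
    finally show "tens K A B a u \<otimes>\<^bsub>SP\<^esub> tens K A B ?d (v' \<otimes>\<^bsub>B\<^esub> w') = \<dots>" .
  qed
  also have "\<dots> = sumL v (\<lambda>k v'. sumR w (\<lambda>w' g'. sumR v' (\<lambda>x g. sumD g' (\<lambda>g\<^sub>1 g\<^sub>2.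
      ?\<Psi> (x \<otimes>\<^bsub>B\<^esub> w') (g \<otimes>\<^bsub>H\<^esub> g\<^sub>1) g\<^sub>2 k))))"
    by (rule sum_cong(2)[OF v], rule rho_sum_twist[OF M _ w]) (intro M_intros elems | assumption)+
  also have "\<dots> = sumL v (\<lambda>k v'. sumR v' (\<lambda>x g. sumR w (\<lambda>w' g'. sumD g' (\<lambda>g\<^sub>1 g\<^sub>2.
      ?\<Psi> (x \<otimes>\<^bsub>B\<^esub> w') (g \<otimes>\<^bsub>H\<^esub> g\<^sub>1) g\<^sub>2 k))))"
    by (rule sum_cong(2)[OF v], rule swapRR) (intro M_intros elems | assumption)+
  also have "\<dots> = sumL v (\<lambda>k v'. sumR v' (\<lambda>x g. ?\<Omega> g k x))"
  proof (rule sum_cong(2)[OF v], rule sum_cong(3), assumption)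
    \<comment> \<open>Fubini: the sums over \<open>\<rho>(w)\<close> and \<open>\<Delta>(g')\<close> move inside those over \<open>\<lambda>(u)\<close> and \<open>\<Delta>(h)\<close>.\<close>
    fix k v' x g
    assume *: "k \<in> carrier H" "v' \<in> carrier B" "x \<in> carrier B" "g \<in> carrier H"
    let ?t = "\<lambda>h\<^sub>1 h\<^sub>2 u' w' g\<^sub>1 g\<^sub>2.
      ?\<Theta> (g \<otimes>\<^bsub>H\<^esub> g\<^sub>1) g\<^sub>2 h\<^sub>1 (h\<^sub>2 \<otimes>\<^bsub>H\<^esub> k) (u' \<otimes>\<^bsub>B\<^esub> (x \<otimes>\<^bsub>B\<^esub> w'))"
    have "sumR w (\<lambda>w' g'. sumD g' (\<lambda>g\<^sub>1 g\<^sub>2. sumL u (\<lambda>h u'. sumD h (\<lambda>h\<^sub>1 h\<^sub>2. ?t h\<^sub>1 h\<^sub>2 u' w' g\<^sub>1 g\<^sub>2))))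
      = sumR w (\<lambda>w' g'. sumL u (\<lambda>h u'. sumD g' (\<lambda>g\<^sub>1 g\<^sub>2. sumD h (\<lambda>h\<^sub>1 h\<^sub>2. ?t h\<^sub>1 h\<^sub>2 u' w' g\<^sub>1 g\<^sub>2))))"
      by (rule sum_cong(3)[OF w], rule swapDL) (intro M_intros elems * | assumption)+
    also have "\<dots> = sumR w (\<lambda>w' g'. sumL u (\<lambda>h u'. sumD h (\<lambda>h\<^sub>1 h\<^sub>2. sumD g' (\<lambda>g\<^sub>1 g\<^sub>2. ?t h\<^sub>1 h\<^sub>2 u' w' g\<^sub>1 g\<^sub>2))))"
      by (rule sum_cong(3)[OF w], rule sum_cong(2)[OF u], rule swapDD)
         (intro M_intros elems * | assumption)+
    also have "\<dots> = sumL u (\<lambda>h u'. sumR w (\<lambda>w' g'. sumD h (\<lambda>h\<^sub>1 h\<^sub>2. sumD g' (\<lambda>g\<^sub>1 g\<^sub>2. ?t h\<^sub>1 h\<^sub>2 u' w' g\<^sub>1 g\<^sub>2))))"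
      by (rule swapRL) (intro M_intros elems * | assumption)+
    also have "\<dots> = sumL u (\<lambda>h u'. sumD h (\<lambda>h\<^sub>1 h\<^sub>2. sumR w (\<lambda>w' g'. sumD g' (\<lambda>g\<^sub>1 g\<^sub>2. ?t h\<^sub>1 h\<^sub>2 u' w' g\<^sub>1 g\<^sub>2))))"
      by (rule sum_cong(2)[OF u], rule swapRD) (intro M_intros elems * | assumption)+
    also have "\<dots> = ?\<Omega> g k x"
      by (intro sum_cong elems; assumption?) (simp add: B.mult_assoc w *)
    finally show "sumR w (\<lambda>w' g'. sumD g' (\<lambda>g\<^sub>1 g\<^sub>2.
      ?\<Psi> (x \<otimes>\<^bsub>B\<^esub> w') (g \<otimes>\<^bsub>H\<^esub> g\<^sub>1) g\<^sub>2 k)) = ?\<Omega> g k x" .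
  qed
  also have "\<dots> = sumR v (\<lambda>v' g. sumL v' (\<lambda>k x. ?\<Omega> g k x))"
    by (rule lam_rho_sum[OF M _ v, where G = "\<lambda>k x g. ?\<Omega> g k x"]) (intro M_intros elems | assumption)+
  finally have right: "tens K A B a u \<otimes>\<^bsub>SP\<^esub> smash_pure b v c w = \<dots>" .

  show ?thesis
    using left right by (simp add: smash_mult_tens elems)
qed

lemma smash_mult_assoc:
  assumes r: "r \<in> carrier M" and s: "s \<in> carrier M" and t: "t \<in> carrier M"
  shows "(r \<otimes>\<^bsub>SP\<^esub> s) \<otimes>\<^bsub>SP\<^esub> t = r \<otimes>\<^bsub>SP\<^esub> (s \<otimes>\<^bsub>SP\<^esub> t)"
proof -
  note ext = tensor_ext[OF mods(2) mods(3) M]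
  note lin = linear_bilinear_left[OF smash_mult_bilinear] linear_bilinear_right[OF smash_mult_bilinear]
    linear_ident bilinear_closed[OF smash_mult_bilinear] closed r s t
  show ?thesis
    by (rule ext[OF _ _ _ r], (intro lin)+, rule ext[OF _ _ _ s], (intro lin | assumption)+,
        rule ext[OF _ _ _ t], (intro lin | assumption)+, rule smash_mult_assoc_tens)
qed

lemma smash_product_assoc_algebra: "assoc_algebra K SP"
proof -
  have eqs: "carrier SP = carrier M" "zero SP = zero M" "add SP = add M" "smult SP = smult M"
    by (simp_all add: smash_product_def Let_def carrier_tensor add_tensor zero_tensor smult_tensor)
  note b = smash_mult_bilinear
  show ?thesis
    by (intro assoc_algebra.intro assoc_algebra_axioms.intro H.field_axioms
        module_transfer[OF M eqs])
       (simp_all add: eqs smash_mult_assoc bilinear_closed[OF b] linear_add[OF bilinear_left[OF b]]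
         linear_add[OF bilinear_right[OF b]] linear_smult[OF bilinear_left[OF b]]
         linear_smult[OF bilinear_right[OF b]])
qed

end

theorem proposition4p2:
  fixes K :: "('k, 'm) ring_scheme"
    and H :: "('k, 'h) module" and \<Delta> :: "'h \<Rightarrow> ('h \<times> 'h \<Rightarrow> 'k) set"
    and \<epsilon> :: "'h \<Rightarrow> 'k" and S :: "'h \<Rightarrow> 'h"
    and A :: "('k, 'a) module" and L :: "('h \<times> 'a \<Rightarrow> 'k) set \<Rightarrow> 'a"
    and R :: "('a \<times> 'h \<Rightarrow> 'k) set \<Rightarrow> 'a"
    and B :: "('k, 'b) module" and lam :: "'b \<Rightarrow> ('h \<times> 'b \<Rightarrow> 'k) set"
    and rho :: "'b \<Rightarrow> ('b \<times> 'h \<Rightarrow> 'k) set"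
  assumes "field K"
    and "hopf_algebra K H \<Delta> \<epsilon> S"
    and "partial_bimodule_algebra K H \<Delta> L A R"
    and "partial_bicomodule_algebra K H \<Delta> \<epsilon> lam B rho"
  shows "assoc_algebra K (smash_product K H L A R lam B rho)"
proof -
  interpret lr_smash_data K H \<Delta> \<epsilon> S A L R B lam rho
    using assms(2-4) by (rule lr_smash_data.intro)
  show ?thesis by (rule smash_product_assoc_algebra)
qed

end
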